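(* There is no data structure that, for every text $T \in \{0,1\}^n$, uses $\mathcal{O}(\delta(T)\log^{\mathcal{O}(1)} n)$ space and answers any one of the following query types on $T$ in $o\big(\tfrac{\log n}{\log\log n}\big)$ time: (i) LCP array queries (given $i \in [1..n]$, return $\mathrm{LCP}_T[i]$); (ii) suffix array queries (given $i\in[1..n]$, return $\mathrm{SA}_T[i]$); (iii) inverse suffix array queries (given $j\in[1..n]$, return $\mathrm{ISA}_T[j]$); (iv) longest common extension queries (given $i,j\in[1..n]$, return $\mathrm{LCE}_T(i,j)$).
   Context: Model: word RAM with word size $w \ge \log n$; space is measured in machine words. Strings are indexed from 1; $T[i..j]$ is a substring. Lexicographic order $\prec$: $U \preceq V$ iff $U$ is a prefix of $V$, or $U$ and $V$ first differ at some position $i$ with $U[i]\prec V[i]$. For $\ell \ge 1$, $d_\ell(T)$ is the number of distinct length-$\ell$ substrings of $T$, and the substring complexity is $\delta(T)=\max_{\ell=1}^{n} d_\ell(T)/\ell$. The suffix array $\mathrm{SA}_T[1..n]$ is the permutation of $[1..n]$ with $T[\mathrm{SA}_T[1]..n]\prec\cdots\prec T[\mathrm{SA}_T[n]..n]$; $\mathrm{ISA}_T$ is its inverse permutation. $\mathrm{LCE}_T(i,j)$ is the length of the longest common prefix of $T[i..n]$ and $T[j..n]$. The LCP array has $\mathrm{LCP}_T[1]=0$ and $\mathrm{LCP}_T[i]=\mathrm{LCE}_T(\mathrm{SA}_T[i],\mathrm{SA}_T[i-1])$ for $i\in[2..n]$.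
   Formalization: The word size w is assumed, besides w ≥ log n, to be at most polylogarithmic in n; for very large words such as w = n^3 all answers fit in one word and the claim fails. *)

theory Defs
  imports
    Complex_Main
    "HOL-Library.Sublist"
    "HOL-Library.Landau_Symbols"
    "HOL-Combinatorics.Permutations"
begin

section \<open>Strings\<close>

text \<open>Binary texts are lists of booleans with \<^term>\<open>False\<close> for 0 and \<^term>\<open>True\<close> for 1.
  Positions are counted from 1, as in the informal development.\<close>

definition substr :: "'a list \<Rightarrow> nat \<Rightarrow> nat \<Rightarrow> 'a list" where
  "substr T i j = take (j + 1 - i) (drop (i - 1) T)"

abbreviation suffix_at :: "'a list \<Rightarrow> nat \<Rightarrow> 'a list" where
  "suffix_at T i \<equiv> substr T i (length T)"

definition lex_less :: "'a::linorder list \<Rightarrow> 'a list \<Rightarrow> bool" where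
  "lex_less U V \<longleftrightarrow> (U, V) \<in> lexord {(a, b). a < b}"

definition num_substrings :: "nat \<Rightarrow> 'a list \<Rightarrow> nat" where
  "num_substrings l T = card {U. sublist U T \<and> length U = l}"

definition substring_complexity :: "'a list \<Rightarrow> real" where
  "substring_complexity T = Max ((\<lambda>l. real (num_substrings l T) / real l) ` {1..length T})"

definition is_suffix_array :: "'a::linorder list \<Rightarrow> (nat \<Rightarrow> nat) \<Rightarrow> bool" where
  "is_suffix_array T sa \<longleftrightarrow> sa permutes {1..length T} \<and>
     (\<forall>i\<in>{1..length T}. \<forall>j\<in>{1..length T}. i < j \<longrightarrow>
        lex_less (suffix_at T (sa i)) (suffix_at T (sa j)))"

definition SA :: "'a::linorder list \<Rightarrow> nat \<Rightarrow> nat" where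
  "SA T = (THE sa. is_suffix_array T sa)"

definition ISA :: "'a::linorder list \<Rightarrow> nat \<Rightarrow> nat" where
  "ISA T = inv (SA T)"

definition LCE :: "'a list \<Rightarrow> nat \<Rightarrow> nat \<Rightarrow> nat" where
  "LCE T i j = length (longest_common_prefix (suffix_at T i) (suffix_at T j))"

definition LCP :: "'a::linorder list \<Rightarrow> nat \<Rightarrow> nat" where
  "LCP T i = (if i = 1 then 0 else LCE T (SA T i) (SA T (i - 1)))"

text \<open>The definite description in \<^const>\<open>SA\<close> is proper.\<close>

lemma lex_less_irrefl: "\<not> lex_less U U"
  by (simp add: lex_less_def lexord_irreflexive)

lemma lex_less_trans: "lex_less U V \<Longrightarrow> lex_less V W \<Longrightarrow> lex_less U W"
  unfolding lex_less_def by (erule lexord_trans) (auto simp: trans_def)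

lemma lex_less_linear: "lex_less U V \<or> U = V \<or> lex_less V U"
  unfolding lex_less_def by (rule lexord_linear[rule_format]) auto

lemma length_suffix_at: "1 \<le> i \<Longrightarrow> i \<le> length T \<Longrightarrow> length (suffix_at T i) = length T + 1 - i"
  by (auto simp: substr_def)

lemma suffix_at_inj:
  assumes "i \<in> {1..length T}" "j \<in> {1..length T}" "suffix_at T i = suffix_at T j"
  shows "i = j"
  using assms length_suffix_at[of i T] length_suffix_at[of j T] by auto

lemma ex1_is_suffix_array:
  fixes T :: "'a::linorder list"
  shows "\<exists>!sa. is_suffix_array T sa"
proof -
  let ?I = "{1..length T}"
  let ?le = "\<lambda>k j. k = j \<or> lex_less (suffix_at T k) (suffix_at T j)"
  define rank where "rank j = (if j \<in> ?I then card {k \<in> ?I. ?le k j} else j)" for j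
  have mono: "rank i < rank j"
    if "i \<in> ?I" "j \<in> ?I" "lex_less (suffix_at T i) (suffix_at T j)" for i j
  proof -
    have "j \<notin> {k \<in> ?I. ?le k i}"
      using that lex_less_irrefl lex_less_trans by blast
    then have "{k \<in> ?I. ?le k i} \<subset> {k \<in> ?I. ?le k j}"
      using that by (auto intro: lex_less_trans)
    then have "card {k \<in> ?I. ?le k i} < card {k \<in> ?I. ?le k j}"
      by (intro psubset_card_mono) auto
    then show ?thesis using that by (simp add: rank_def)
  qed
  have lin: "lex_less (suffix_at T i) (suffix_at T j) \<or> i = j \<or> lex_less (suffix_at T j) (suffix_at T i)"
    if "i \<in> ?I" "j \<in> ?I" for i j
    using lex_less_linear suffix_at_inj that by blast
  have inj: "inj_on rank ?I"
    using mono lin by (metis (no_types, lifting) inj_onI less_irrefl)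
  have "rank j \<in> ?I" if "j \<in> ?I" for j
  proof -
    have "card {k \<in> ?I. ?le k j} \<le> card ?I" by (intro card_mono) auto
    moreover have "card {k \<in> ?I. ?le k j} > 0" using that by (auto simp: card_gt_0_iff)
    ultimately show ?thesis using that by (simp add: rank_def)
  qed
  then have "rank ` ?I = ?I"
    by (intro endo_inj_surj[OF _ _ inj]) auto
  then have perm: "rank permutes ?I"
    using inj by (intro bij_imp_permutes) (auto simp: bij_betw_def rank_def)
  have ex: "is_suffix_array T (inv rank)"
    unfolding is_suffix_array_def
  proof (intro conjI ballI impI)
    show "inv rank permutes ?I" by (rule permutes_inv[OF perm])
    fix i j assume ij: "i \<in> ?I" "j \<in> ?I" "i < j"
    have mem: "inv rank i \<in> ?I" "inv rank j \<in> ?I"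
      using ij permutes_in_image[OF permutes_inv[OF perm]] by auto
    have "rank (inv rank i) = i" "rank (inv rank j) = j"
      using permutes_inverses[OF perm] by auto
    then show "lex_less (suffix_at T (inv rank i)) (suffix_at T (inv rank j))"
      using lin[OF mem] mono[OF mem(2) mem(1)] ij(3) by fastforce
  qed
  have uniq: "sa = inv rank" if sa: "is_suffix_array T sa" for sa
  proof -
    have p: "sa permutes ?I" using sa by (simp add: is_suffix_array_def)
    have "rank (sa i) = i" for i
    proof (cases "i \<in> ?I")
      case True
      have si: "sa k \<in> ?I \<longleftrightarrow> k \<in> ?I" for k using permutes_in_image[OF p] .
      have cmp: "?le (sa k) (sa i) \<longleftrightarrow> k \<le> i" if "k \<in> ?I" for k
        using sa True that permutes_inj[OF p] lex_less_irrefl lex_less_trans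
        unfolding is_suffix_array_def by (metis injD linorder_cases order.order_iff_strict not_le)
      have "{k \<in> ?I. ?le k (sa i)} = sa ` {1..i}"
      proof (intro equalityI subsetI)
        fix k assume k: "k \<in> {k \<in> ?I. ?le k (sa i)}"
        obtain m where m: "k = sa m" using permutes_surj[OF p] by (metis surjD)
        show "k \<in> sa ` {1..i}" using k cmp[of m] si[of m] unfolding m by auto
      next
        fix k assume "k \<in> sa ` {1..i}"
        then obtain m where m: "k = sa m" "m \<in> {1..i}" by auto
        have "m \<in> ?I" using m True by auto
        then show "k \<in> {k \<in> ?I. ?le k (sa i)}" using m cmp[of m] si[of m] by auto
      qed
      moreover have "card (sa ` {1..i}) = i"
        using permutes_inj[OF p] by (simp add: card_image inj_on_subset)
      ultimately show ?thesis using si True by (simp add: rank_def)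
    next
      case False
      then show ?thesis unfolding permutes_not_in[OF p False] rank_def by (rule if_not_P)
    qed
    then show ?thesis using permutes_inverses(2)[OF perm] by (metis ext)
  qed
  show ?thesis using ex uniq by blast
qed


section \<open>The word RAM\<close>

text \<open>
  Machine words of size \<^term>\<open>w\<close> are the natural numbers below \<^term>\<open>2 ^ w\<close>; since \<^term>\<open>w\<close> grows
  with the input length it is a parameter of the semantics rather than part of a type.  A program
  is a fixed finite list of instructions (so it uses a constant number of registers), every
  instruction takes unit time, and memory is addressed by words.
\<close>

datatype binop = Add | Sub | Mul | Div | Mod | And | Or | Xor | Shl | Shr | Less | Equal

fun eval_binop :: "nat \<Rightarrow> binop \<Rightarrow> nat \<Rightarrow> nat \<Rightarrow> nat" where
  "eval_binop w Add a b = (a + b) mod 2 ^ w"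
| "eval_binop w Sub a b = (a + 2 ^ w - b) mod 2 ^ w"
| "eval_binop w Mul a b = (a * b) mod 2 ^ w"
| "eval_binop w Div a b = a div b"
| "eval_binop w Mod a b = a mod b"
| "eval_binop w And a b = Bit_Operations.and a b"
| "eval_binop w Or a b = Bit_Operations.or a b"
| "eval_binop w Xor a b = Bit_Operations.xor a b"
| "eval_binop w Shl a b = push_bit b a mod 2 ^ w"
| "eval_binop w Shr a b = drop_bit b a"
| "eval_binop w Less a b = of_bool (a < b) mod 2 ^ w"
| "eval_binop w Equal a b = of_bool (a = b) mod 2 ^ w"

datatype instr =
    LoadConst nat nat         \<comment> \<open>destination register, constant\<close>
  | Binop binop nat nat nat   \<comment> \<open>operation, destination register, operand registers\<close>
  | Load nat nat              \<comment> \<open>destination register, register holding the address\<close>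
  | Store nat nat             \<comment> \<open>register holding the address, source register\<close>
  | JumpIfZero nat nat        \<comment> \<open>tested register, position in the program\<close>

type_synonym program = "instr list"

record ram_state =
  pc :: nat
  reg :: "nat \<Rightarrow> nat"
  mem :: "nat \<Rightarrow> nat"

fun exec_instr :: "nat \<Rightarrow> instr \<Rightarrow> ram_state \<Rightarrow> ram_state" where
  "exec_instr w (LoadConst r c) s =
     s\<lparr>pc := pc s + 1, reg := (reg s)(r := c mod 2 ^ w)\<rparr>"
| "exec_instr w (Binop f r r1 r2) s =
     s\<lparr>pc := pc s + 1, reg := (reg s)(r := eval_binop w f (reg s r1) (reg s r2))\<rparr>"
| "exec_instr w (Load r ra) s =
     s\<lparr>pc := pc s + 1, reg := (reg s)(r := mem s (reg s ra))\<rparr>"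
| "exec_instr w (Store ra r) s =
     s\<lparr>pc := pc s + 1, mem := (mem s)(reg s ra := reg s r)\<rparr>"
| "exec_instr w (JumpIfZero r l) s =
     s\<lparr>pc := (if reg s r = 0 then l else pc s + 1)\<rparr>"

text \<open>A program halts by leaving its range of positions.\<close>

definition halted :: "program \<Rightarrow> ram_state \<Rightarrow> bool" where
  "halted P s \<longleftrightarrow> length P \<le> pc s"

definition step :: "nat \<Rightarrow> program \<Rightarrow> ram_state \<Rightarrow> ram_state" where
  "step w P s = (if halted P s then s else exec_instr w (P ! pc s) s)"

text \<open>Initially the arguments are in the first registers and the stored words at the addresses
  from 0 on.  All other registers and cells are zero, and the latter may serve as scratch memory.
  An index in \<open>[1..n]\<close> or a value in \<open>[0..n]\<close> is represented modulo \<open>2 ^ w\<close>, which matters only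
  for the value \<open>n\<close> in the borderline case \<open>n = 2 ^ w\<close> permitted by \<open>w \<ge> log n\<close>.\<close>

definition init_state :: "nat \<Rightarrow> nat list \<Rightarrow> nat list \<Rightarrow> ram_state" where
  "init_state w M args =
     \<lparr>pc = 0,
      reg = (\<lambda>r. if r < length args then args ! r mod 2 ^ w else 0),
      mem = (\<lambda>a. if a < length M then M ! a else 0)\<rparr>"

definition computes_within ::
  "nat \<Rightarrow> program \<Rightarrow> nat list \<Rightarrow> nat list \<Rightarrow> nat \<Rightarrow> real \<Rightarrow> bool" where
  "computes_within w P M args v \<tau> \<longleftrightarrow>
     (\<exists>k. real k \<le> \<tau> \<and>
        (let s = (step w P ^^ k) (init_state w M args) in halted P s \<and> reg s 0 = v mod 2 ^ w))"


section \<open>Data structures for string queries\<close>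

datatype query_type = LCP_Query | SA_Query | ISA_Query | LCE_Query

fun query_args :: "query_type \<Rightarrow> nat \<Rightarrow> nat list set" where
  "query_args LCE_Query n = {[i, j] | i j. i \<in> {1..n} \<and> j \<in> {1..n}}"
| "query_args _ n = {[i] | i. i \<in> {1..n}}"

fun query_answer :: "query_type \<Rightarrow> bool list \<Rightarrow> nat list \<Rightarrow> nat" where
  "query_answer LCP_Query T xs = LCP T (xs ! 0)"
| "query_answer SA_Query T xs = SA T (xs ! 0)"
| "query_answer ISA_Query T xs = ISA T (xs ! 0)"
| "query_answer LCE_Query T xs = LCE T (xs ! 0) (xs ! 1)"

text \<open>The asymptotic regime for texts is that of their length tending to infinity, uniformly over
  all texts of the same length.\<close>

abbreviation long_texts :: "bool list filter" where
  "long_texts \<equiv> filtercomap length at_top"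

text \<open>A data structure consists of an encoding \<open>D\<close>, which maps each text to the words stored for
  it (without any restriction on construction time), and a query program \<open>P\<close>.  Here \<open>w n\<close> is the
  word size and \<open>t n\<close> the bound on the time of each query for texts of length \<open>n\<close>.  A lower bound
  needs \<open>w\<close> to be at most polylogarithmic: a word of polynomially many bits can hold the table of
  all answers, from which each one is extracted by a shift and a mask.\<close>

definition answers_queries ::
  "query_type \<Rightarrow> (nat \<Rightarrow> nat) \<Rightarrow> (bool list \<Rightarrow> nat list) \<Rightarrow> program \<Rightarrow> (nat \<Rightarrow> real) \<Rightarrow> bool" where
  "answers_queries q w D P t \<longleftrightarrow>
     (\<forall>\<^sub>F T in long_texts.
        (\<forall>x\<in>set (D T). x < 2 ^ w (length T)) \<and>
        (\<forall>xs\<in>query_args q (length T).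
           computes_within (w (length T)) P (D T) xs (query_answer q T xs) (t (length T))))"

definition delta_polylog_space :: "(bool list \<Rightarrow> nat list) \<Rightarrow> bool" where
  "delta_polylog_space D \<longleftrightarrow>
     (\<exists>c::nat. (\<lambda>T. real (length (D T)))
        \<in> O[long_texts](\<lambda>T. substring_complexity T * log 2 (real (length T)) ^ c))"

end

theory Submission
  imports Defs "HOL-Library.FuncSet"
begin

text \<open>
  The bound is a counting argument in the cell-probe model.  For a set \<open>F\<close> of pairs \<open>(i, v)\<close> with
  \<open>i < d\<close> and \<open>v < B\<close>, and a digit sequence \<open>x\<close>, consider the parity of the number of \<open>i\<close> with
  \<open>(i, x i) \<in> F\<close>.  For each query type there are highly compressible texts of length
  \<open>B\<^bsup>O(d)\<^esup>\<close>, one for each \<open>F\<close>, on which one query reveals this parity for any given \<open>x\<close>.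

  If a query makes \<open>t\<close> probes into \<open>S\<close> cells, then one sequence of \<open>t\<close> addresses is shared by at
  least \<open>B\<^bsup>d\<^esup> / (S + 1)\<^bsup>t\<^esup>\<close> of the \<open>B\<^bsup>d\<^esup>\<close> digit sequences, and the contents of these \<open>t\<close> cells
  determine all their parities.  But any \<open>Y\<^bsup>d\<^esup>\<close> digit sequences involve at least \<open>d (Y - 1)\<close>
  linearly independent parities.  With \<open>B\<close> a large power of \<open>d\<close>, and \<open>S\<close> and the word size
  polynomial in \<open>d\<close>, this forces \<open>t = \<Omega>(d) = \<Omega>(log n / log log n)\<close>.
\<close>

section \<open>Parities of digit sequences\<close>

primrec digit_parity :: "nat \<Rightarrow> (nat \<times> nat) set \<Rightarrow> (nat \<Rightarrow> nat) \<Rightarrow> bool" where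
  "digit_parity 0 F x = False"
| "digit_parity (Suc d) F x = (digit_parity d F x \<noteq> ((d, x d) \<in> F))"

text \<open>This is linearity over GF(2): symmetric difference is addition of sets, and for fixed
  \<open>x\<close> the parity is a linear functional.\<close>

lemma digit_parity_sym_diff: "digit_parity d ((F - G) \<union> (G - F)) x = (digit_parity d F x \<noteq> digit_parity d G x)"
  by (induction d) auto

lemma digit_parity_singleton: "digit_parity d {(i, v)} x \<longleftrightarrow> i < d \<and> x i = v"
  by (induction d) (auto simp: less_Suc_eq)

lemma digit_parity_cong:
  assumes "\<And>i. i < d \<Longrightarrow> (i, x i) \<in> F \<longleftrightarrow> (i, y i) \<in> G"
  shows "digit_parity d F x = digit_parity d G y"
  using assms by (induction d) auto

abbreviation queries :: "nat \<Rightarrow> nat \<Rightarrow> (nat \<Rightarrow> nat) set" where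
  "queries d B \<equiv> {..<d} \<rightarrow>\<^sub>E {..<B}"

text \<open>This is an instance of the inequality of arithmetic and geometric means, since the
  factors have average at most \<open>Y\<close>. It follows from \<open>1 + z \<le> exp z\<close> at
  \<open>z = Suc (r i) / Y - 1\<close>.\<close>

lemma prod_Suc_le_power:
  fixes r :: "nat \<Rightarrow> nat"
  assumes "d + (\<Sum>i<d. r i) \<le> d * Y" "0 < Y"
  shows "(\<Prod>i<d. Suc (r i)) \<le> Y ^ d"
proof -
  have "(\<Prod>i<d. real (Suc (r i)) / Y) \<le> (\<Prod>i<d. exp (real (Suc (r i)) / Y - 1))"
  proof (intro prod_mono conjI)
    fix i show "real (Suc (r i)) / Y \<le> exp (real (Suc (r i)) / Y - 1)"
      using exp_ge_add_one_self[of "real (Suc (r i)) / Y - 1"] by simp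
  qed simp
  also have "\<dots> = exp (\<Sum>i<d. real (Suc (r i)) / Y - 1)"
    by (simp add: exp_sum)
  also have "(\<Sum>i<d. real (Suc (r i)) / Y - 1) = real (d + (\<Sum>i<d. r i)) / Y - d"
    by (simp add: sum_subtractf sum_divide_distrib[symmetric] sum.distrib add_divide_distrib)
  also have "real (d + (\<Sum>i<d. r i)) / Y \<le> d"
    using assms by (simp add: divide_le_eq flip: of_nat_add of_nat_mult of_nat_sum)
  hence "exp (real (d + (\<Sum>i<d. r i)) / Y - d) \<le> 1" by simp
  finally have "(\<Prod>i<d. real (Suc (r i))) \<le> real Y ^ d"
    using assms(2) by (simp add: prod_dividef divide_le_eq)
  hence "real (\<Prod>i<d. Suc (r i)) \<le> real (Y ^ d)" by simp
  thus ?thesis by (simp only: of_nat_le_iff)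
qed

text \<open>\<open>J\<close> is a maximal set of pairs whose indicator functions on \<open>X\<close> are linearly independent over
  \<open>GF(2)\<close>.  All other indicators are combinations of these, so an element of \<open>X\<close> is determined by
  its values on \<open>J\<close>.\<close>

lemma parity_fiber:
  assumes X: "X \<subseteq> queries d B" and card_X: "Y ^ d < card X" and "0 < Y"
  shows "card {F. F \<subseteq> {..<d} \<times> {..<B} \<and> (\<forall>x\<in>X. digit_parity d F x = digit_parity d F0 x)} * 2 ^ (d * Y - d) \<le> 2 ^ (d * B)"
proof -
  let ?U = "{..<d} \<times> {..<B}"
  \<comment> \<open>The parity of \<open>K\<close> is the GF(2) sum of its indicators, so
    independence says that no nonempty sum of elements of \<open>J\<close> vanishes on all of
    \<open>X\<close>.\<close>
  define indep where "indep J \<longleftrightarrow> J \<subseteq> ?U \<and> (\<forall>K\<subseteq>J. K \<noteq> {} \<longrightarrow> (\<exists>x\<in>X. digit_parity d K x))" for J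
  have "finite {J. indep J}"
    by (rule finite_subset[of _ "Pow ?U"]) (auto simp: indep_def)
  moreover have "indep {}" by (auto simp: indep_def)
  ultimately obtain J where J: "indep J" and max: "\<And>K. indep K \<Longrightarrow> J \<subseteq> K \<Longrightarrow> K = J"
    using finite_has_maximal[of "{J. indep J}"] by (metis empty_iff mem_Collect_eq)
  have JU: "J \<subseteq> ?U" using J by (simp add: indep_def)
  then have fin: "finite J" by (rule finite_subset) auto
  define sig where "sig x = restrict (\<lambda>i. if (i, x i) \<in> J then Suc (x i) else 0) {..<d}" for x :: "nat \<Rightarrow> nat"
  have "inj_on sig X"
  proof (rule inj_onI)
    fix x y assume xy: "x \<in> X" "y \<in> X" "sig x = sig y"
    have eqJ: "digit_parity d K x = digit_parity d K y" if "K \<subseteq> J" for K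
    proof (rule digit_parity_cong)
      fix i assume "i < d"
      then show "(i, x i) \<in> K \<longleftrightarrow> (i, y i) \<in> K"
        using fun_cong[OF xy(3), of i] that by (auto simp: sig_def split: if_splits)
    qed
    have "x i = y i" if i: "i < d" for i
    proof (rule ccontr)
      assume ne: "x i \<noteq> y i"
      have U: "(i, x i) \<in> ?U" using X xy(1) i by auto
      have "(i, x i) \<notin> J" using fun_cong[OF xy(3), of i] i ne by (auto simp: sig_def split: if_splits)
      \<comment> \<open>By maximality some \<open>K\<close> containing \<open>(i, x i)\<close> has
        parity zero on \<open>X\<close>. Removing that pair leaves a subset of \<open>J\<close>
        whose parity on \<open>X\<close> is the indicator of \<open>z i = x i\<close>, so the equal
        signatures force \<open>y i = x i\<close>.\<close>
      then have "\<not> indep (insert (i, x i) J)" using max by blast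
      then obtain K where K: "K \<subseteq> insert (i, x i) J" "K \<noteq> {}" "\<And>z. z \<in> X \<Longrightarrow> \<not> digit_parity d K z"
        using JU U unfolding indep_def by blast
      have "(i, x i) \<in> K" using J K unfolding indep_def by blast
      then have eq: "(K - {(i, x i)}) = (K - {(i, x i)}) \<union> ({(i, x i)} - K)" by auto
      have "digit_parity d (K - {(i, x i)}) z = (z i = x i)" if "z \<in> X" for z
        by (subst eq) (use K(3)[OF that] i in \<open>simp only: digit_parity_sym_diff digit_parity_singleton, simp\<close>)
      moreover have "digit_parity d (K - {(i, x i)}) x = digit_parity d (K - {(i, x i)}) y"
        using K(1) by (intro eqJ) auto
      ultimately show False using xy ne by auto
    qed
    then show "x = y" using X xy by (intro PiE_ext[of x "{..<d}" "\<lambda>_. {..<B}"]) auto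
  qed
  then have "card X = card (sig ` X)" by (simp add: card_image)
  also have "\<dots> \<le> card (PiE {..<d} (\<lambda>i. insert 0 (Suc ` (J `` {i}))))"
    by (intro card_mono finite_PiE) (auto simp: sig_def fin PiE_iff intro!: finite_imageI finite_Image split: if_splits)
  also have "\<dots> = (\<Prod>i<d. Suc (card (J `` {i})))"
    using fin by (subst card_PiE) (auto simp: card_image finite_Image)
  finally have cX: "card X \<le> (\<Prod>i<d. Suc (card (J `` {i})))" .
  have "J = Sigma {..<d} (\<lambda>i. J `` {i})" using JU by auto
  then have "card J = (\<Sum>i<d. card (J `` {i}))"
    using fin by (metis card_SigmaI finite_Image finite_lessThan)
  \<comment> \<open>A smaller \<open>J\<close> would allow at most \<open>Y ^ d\<close> signatures,
    by \<open>prod_Suc_le_power\<close>, against the size of \<open>X\<close>.\<close>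
  then have cJ: "d * Y - d \<le> card J"
    using prod_Suc_le_power[of d "\<lambda>i. card (J `` {i})" Y] cX card_X assms(3) by linarith
  let ?A = "{F. F \<subseteq> ?U \<and> (\<forall>x\<in>X. digit_parity d F x = digit_parity d F0 x)}"
  \<comment> \<open>Two members of the fiber that agree outside \<open>J\<close> differ by a subset
    of \<open>J\<close> with parity zero on \<open>X\<close>, which independence forces to be
    empty.\<close>
  have "inj_on (\<lambda>F. F - J) ?A"
  proof (rule inj_onI)
    fix F G assume FG: "F \<in> ?A" "G \<in> ?A" "F - J = G - J"
    then have "(F - G) \<union> (G - F) \<subseteq> J" by auto
    moreover have "\<not> digit_parity d ((F - G) \<union> (G - F)) x" if "x \<in> X" for x
      using FG that by (simp add: digit_parity_sym_diff)
    ultimately have "(F - G) \<union> (G - F) = {}" using J unfolding indep_def by blast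
    then show "F = G" by auto
  qed
  then have "card ?A \<le> card (Pow (?U - J))"
    by (rule card_inj_on_le) auto
  also have "\<dots> = 2 ^ (d * B - card J)"
    using JU fin by (simp add: card_Pow card_Diff_subset)
  finally have "card ?A * 2 ^ (d * Y - d) \<le> 2 ^ (d * B - card J) * 2 ^ card J"
    using cJ by (intro mult_mono power_increasing) auto
  also have "\<dots> = 2 ^ (d * B)"
    using card_mono[OF _ JU] by (simp flip: power_add)
  finally show ?thesis .
qed

section \<open>Cell probes\<close>

text \<open>The value \<open>S\<close> stands for no probe and for a probe beyond the stored words, where all cells
  are initially zero.\<close>

definition probe :: "nat \<Rightarrow> program \<Rightarrow> ram_state \<Rightarrow> nat" where
  "probe S P s = (if halted P s then S else case P ! pc s of Load r ra \<Rightarrow> min S (reg s ra) | _ \<Rightarrow> S)"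


lemma funpow_step_halted:
  assumes "halted P ((step w P ^^ k) s)" "k \<le> t"
  shows "(step w P ^^ t) s = (step w P ^^ k) s"
  using assms(2)
proof (induction t rule: dec_induct)
  case (step n)
  have "(step w P ^^ Suc n) s = step w P ((step w P ^^ k) s)"
    using step.IH by simp
  also have "\<dots> = (step w P ^^ k) s"
    by (simp only: step_def[of w P "(step w P ^^ k) s"] assms(1) if_True)
  finally show ?case .
qed simp

text \<open>Memory influences registers and control only through loads. While all loaded addresses
  lie in \<open>A\<close>, both runs coincide there, and a store writes the same value to the same
  address in both. All of \<open>{S..}\<close> must be in \<open>A\<close> because
  \<open>probe\<close> reports every address beyond \<open>S\<close> as \<open>S\<close>.\<close>

lemma funpow_step_agree:
  assumes reg: "reg s = reg s'" and pc: "pc s = pc s'"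
    and mem: "\<And>a. a \<in> A \<Longrightarrow> mem s a = mem s' a"
    and probes: "\<And>i. i < t \<Longrightarrow> probe S P ((step w P ^^ i) s) \<in> A" and A: "{S..} \<subseteq> A"
  shows "reg ((step w P ^^ t) s) = reg ((step w P ^^ t) s') \<and>
         pc ((step w P ^^ t) s) = pc ((step w P ^^ t) s') \<and>
         (\<forall>a\<in>A. mem ((step w P ^^ t) s) a = mem ((step w P ^^ t) s') a)"
  using probes
proof (induction t)
  case (Suc t)
  define u where "u = (step w P ^^ t) s"
  define v where "v = (step w P ^^ t) s'"
  have IH: "reg u = reg v" "pc u = pc v" "\<And>a. a \<in> A \<Longrightarrow> mem u a = mem v a"
    using Suc unfolding u_def v_def by auto
  have pr: "probe S P u \<in> A" using Suc.prems[of t] by (simp add: u_def)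
  have h: "halted P u = halted P v" using IH by (simp add: halted_def)
  have "reg (step w P u) = reg (step w P v) \<and> pc (step w P u) = pc (step w P v) \<and>
      (\<forall>a\<in>A. mem (step w P u) a = mem (step w P v) a)"
  proof (cases "halted P u")
    case False
    show ?thesis
    proof (cases "P ! pc u")
      case (Load r ra)
      have "reg u ra \<in> A"
        using pr False Load A by (cases "S \<le> reg u ra") (auto simp: probe_def min_def)
      then show ?thesis using False h IH Load by (simp add: step_def)
    qed (use False h IH in \<open>auto simp: step_def\<close>)
  qed (use h IH in \<open>simp add: step_def\<close>)
  then show ?case by (simp add: u_def v_def)
qed (use assms in simp)

lemma ex_large_fiber:
  assumes "finite A" "finite C" "f ` A \<subseteq> C" "C \<noteq> {}"
  shows "\<exists>c\<in>C. card A \<le> card C * card {a \<in> A. f a = c}"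
proof (rule ccontr)
  assume "\<not> ?thesis"
  then have less: "card C * card {a \<in> A. f a = c} < card A" if "c \<in> C" for c
    using that by (auto simp: not_le)
  have "A = (\<Union>c\<in>C. {a \<in> A. f a = c})" using assms(3) by auto
  then have "card A = (\<Sum>c\<in>C. card {a \<in> A. f a = c})"
    using assms by (subst (1) \<open>A = _\<close>, subst card_UN_disjoint) auto
  then have "card C * card A = (\<Sum>c\<in>C. card C * card {a \<in> A. f a = c})"
    by (simp add: sum_distrib_left)
  also have "\<dots> < (\<Sum>c\<in>C. card A)"
    using assms less by (intro sum_strict_mono) auto
  finally show False by simp
qed

text \<open>The pigeonhole principle is applied twice. For each \<open>F\<close>, many queries,
  forming \<open>X F\<close>, share the probe sequence \<open>b F\<close>; and many \<open>F\<close>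
  share the same \<open>code\<close>, which adds the contents of these cells. The latter agree in
  all parities on one set \<open>X F0\<close>, so \<open>parity_fiber\<close> bounds their number,
  which contradicts the second pigeonhole bound.\<close>

lemma parity_cell_probe_bound:
  fixes M :: "(nat \<times> nat) set \<Rightarrow> nat list" and args :: "(nat \<Rightarrow> nat) \<Rightarrow> nat list"
  defines "U \<equiv> \<lambda>d B. {..<d} \<times> {..<B}"
  defines "state \<equiv> \<lambda>w P F x i. (step w P ^^ i) (init_state w (M F) (args x))"
  assumes words: "\<And>F a. F \<subseteq> U d B \<Longrightarrow> a \<in> set (M F) \<Longrightarrow> a < 2 ^ w"
    and size: "\<And>F. F \<subseteq> U d B \<Longrightarrow> length (M F) \<le> S" "Suc S \<le> 2 ^ s"
    and out: "\<And>F G x. F \<subseteq> U d B \<Longrightarrow> G \<subseteq> U d B \<Longrightarrow> x \<in> queries d B \<Longrightarrow>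
      reg (state w P F x t) 0 = reg (state w P G x t) 0 \<Longrightarrow> digit_parity d F x = digit_parity d G x"
    and bound: "d + (s + w) * t < d * Y"
  shows "B ^ d \<le> 2 ^ (s * t) * Y ^ d"
proof (rule ccontr)
  assume large: "\<not> ?thesis"
  have "0 < Y" using bound by (cases Y) auto
  define cell where "cell F a = (if a < length (M F) then M F ! a else 0)" for F a
  define probes where "probes F x = map (\<lambda>i. probe S P (state w P F x i)) [0..<t]" for F x
  define seqs where "seqs = {b. set b \<subseteq> {..S} \<and> length b = t}"
  have fin_seqs: "finite seqs" and seqs_card: "card seqs = Suc S ^ t"
    unfolding seqs_def by (auto simp: finite_lists_length_eq card_lists_length_eq)
  have seqs_ne: "seqs \<noteq> {}" using seqs_card by auto
  have probes: "probes F x \<in> seqs" for F x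
    by (auto simp: probes_def seqs_def probe_def split: instr.splits)
  have "\<exists>b\<in>seqs. card (queries d B) \<le> card seqs * card {x \<in> queries d B. probes F x = b}" for F
    using probes fin_seqs seqs_ne by (intro ex_large_fiber) (auto intro!: finite_PiE)
  then obtain b where b: "\<And>F. b F \<in> seqs"
    and popular: "\<And>F. B ^ d \<le> card seqs * card {x \<in> queries d B. probes F x = b F}"
    by (simp add: card_PiE) metis
  define X where "X F = {x \<in> queries d B. probes F x = b F}" for F
  \<comment> \<open>If the popular class were small, the first pigeonhole bound would already give
    the inequality that is assumed to fail.\<close>
  have X_large: "Y ^ d < card (X F)" for F
  proof (rule ccontr)
    assume "\<not> ?thesis"
    then have "B ^ d \<le> Suc S ^ t * Y ^ d"
      using popular[of F] unfolding seqs_card X_def[symmetric]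
      by (meson le_trans mult_le_mono2 not_less)
    also have "\<dots> \<le> (2 ^ s) ^ t * Y ^ d"
      using size(2) by (intro mult_le_mono1 power_mono) auto
    finally show False using large by (simp add: power_mult)
  qed
  define code where "code F = (b F, map (cell F) (b F))" for F
  define codes where "codes = seqs \<times> {c. set c \<subseteq> {..<2 ^ w::nat} \<and> length c = t}"
  have fin_codes: "finite codes" and codes_card: "card codes = Suc S ^ t * (2 ^ w) ^ t"
    unfolding codes_def using fin_seqs seqs_card
    by (auto simp: finite_lists_length_eq card_lists_length_eq card_cartesian_product)
  have codes_ne: "codes \<noteq> {}"
    using codes_card by auto
  have cell_less: "cell F a < 2 ^ w" if "F \<subseteq> U d B" for F a
    using words[OF that] by (auto simp: cell_def)
  have code: "code F \<in> codes" if "F \<subseteq> U d B" for F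
    using b[of F] cell_less[OF that] by (auto simp: code_def codes_def seqs_def)
  \<comment> \<open>Nothing is known in advance about the probes of \<open>G\<close> on
    \<open>x\<close>. The run for \<open>F\<close> loads only from \<open>b F\<close> or from
    addresses at least \<open>S\<close>; the initial memories agree on both, the latter cells being
    zero, so the run for \<open>G\<close> is the same.\<close>
  have agree: "digit_parity d F x = digit_parity d G x"
    if F: "F \<subseteq> U d B" and G: "G \<subseteq> U d B" and eq: "code F = code G" and x: "x \<in> X F" for F G x
  proof (rule out[OF F G])
    have bFG: "b G = b F" and cells: "\<And>a. a \<in> set (b F) \<Longrightarrow> cell F a = cell G a"
      using eq by (auto simp: code_def)
    define A where "A = set (b F) \<union> {S..}"
    have "reg (state w P F x t) = reg (state w P G x t) \<and> pc (state w P F x t) = pc (state w P G x t) \<and>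
         (\<forall>a\<in>A. mem (state w P F x t) a = mem (state w P G x t) a)"
      unfolding state_def
    proof (rule funpow_step_agree)
      fix a assume "a \<in> A"
      moreover have "cell H a = 0" if "H \<subseteq> U d B" "S \<le> a" for H
        using size(1)[OF that(1)] that(2) by (simp add: cell_def)
      ultimately have "cell F a = cell G a"
        using cells F G by (fastforce simp: A_def)
      then show "mem (init_state w (M F) (args x)) a = mem (init_state w (M G) (args x)) a"
        by (simp add: init_state_def cell_def)
    next
      fix i assume "i < t"
      then have "probe S P (state w P F x i) \<in> set (probes F x)" by (simp add: probes_def)
      then show "probe S P ((step w P ^^ i) (init_state w (M F) (args x))) \<in> A"
        using x by (simp add: X_def A_def state_def)
    qed (auto simp: A_def init_state_def)
    then show "reg (state w P F x t) 0 = reg (state w P G x t) 0" by simp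
    show "x \<in> queries d B" using x by (simp add: X_def)
  qed
  have "\<exists>c\<in>codes. card (Pow (U d B)) \<le> card codes * card {F \<in> Pow (U d B). code F = c}"
    using fin_codes codes_ne code by (intro ex_large_fiber) (auto simp: U_def)
  then obtain c where c: "card (Pow (U d B)) \<le> card codes * card {F \<in> Pow (U d B). code F = c}"
    by blast
  have "{F \<in> Pow (U d B). code F = c} \<noteq> {}"
  proof
    assume "{F \<in> Pow (U d B). code F = c} = {}"
    with c have "card (Pow (U d B)) \<le> 0" by (simp only: card.empty mult_0_right)
    then show False by (simp add: card_Pow U_def)
  qed
  then obtain F0 where F0: "F0 \<subseteq> U d B" "code F0 = c" by auto
  let ?fiber = "{F. F \<subseteq> U d B \<and> (\<forall>x\<in>X F0. digit_parity d F x = digit_parity d F0 x)}"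
  have "finite (U d B)" by (simp add: U_def)
  then have "finite ?fiber" by simp
  moreover have "{F \<in> Pow (U d B). code F = c} \<subseteq> ?fiber"
  proof
    fix G assume "G \<in> {F \<in> Pow (U d B). code F = c}"
    then show "G \<in> ?fiber" using agree[OF F0(1), of G] F0(2) by simp
  qed
  ultimately have "card {F \<in> Pow (U d B). code F = c} \<le> card ?fiber" by (rule card_mono)
  then have "card codes * card {F \<in> Pow (U d B). code F = c} \<le> card codes * card ?fiber"
    by (rule mult_le_mono2)
  moreover have "card (Pow (U d B)) = 2 ^ (d * B)" by (simp add: card_Pow U_def)
  ultimately have main: "2 ^ (d * B) \<le> card codes * card ?fiber" using c by linarith
  have "card codes \<le> (2 ^ s) ^ t * (2 ^ w) ^ t"
    unfolding codes_card using size(2) by (intro mult_le_mono1 power_mono) auto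
  also have "\<dots> = 2 ^ ((s + w) * t)"
    by (simp add: power_mult[symmetric] power_add[symmetric] add_mult_distrib)
  finally have "card codes * card ?fiber \<le> 2 ^ ((s + w) * t) * card ?fiber"
    by (rule mult_le_mono1)
  with main have main: "2 ^ (d * B) \<le> 2 ^ ((s + w) * t) * card ?fiber" by (rule le_trans)
  \<comment> \<open>The fiber has at least \<open>2 ^ (d * B)\<close> divided by the number of codes
    and at most \<open>2 ^ (d * B)\<close> divided by \<open>2 ^ (d * Y - d)\<close>; comparing
    exponents contradicts \<open>bound\<close>.\<close>
  have "card ?fiber * 2 ^ (d * Y - d) \<le> 2 ^ (d * B)"
    unfolding U_def using X_large[of F0] \<open>0 < Y\<close> by (intro parity_fiber) (auto simp: X_def)
  then have "2 ^ ((s + w) * t) * (card ?fiber * 2 ^ (d * Y - d)) \<le> 2 ^ ((s + w) * t) * 2 ^ (d * B)"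
    by (rule mult_le_mono2)
  moreover have "2 ^ (d * B) * 2 ^ (d * Y - d) \<le> 2 ^ ((s + w) * t) * card ?fiber * 2 ^ (d * Y - d)"
    using main by (rule mult_le_mono1)
  ultimately have "2 ^ (d * B) * 2 ^ (d * Y - d) \<le> 2 ^ (d * B) * (2 ^ ((s + w) * t) :: nat)"
    by (simp only: mult.assoc mult.commute[of "2 ^ ((s + w) * t)" "2 ^ (d * B)"])
  then have "2 ^ (d * Y - d) \<le> (2 ^ ((s + w) * t) :: nat)" by simp
  then have "d * Y - d \<le> (s + w) * t" by (rule power_le_imp_le_exp[rotated]) simp
  then show False using bound by linarith
qed

section \<open>Grammars and substring complexity\<close>

definition substrings :: "nat \<Rightarrow> 'a list set \<Rightarrow> 'a list set" where
  "substrings l A = {U. length U = l \<and> (\<exists>s\<in>A. sublist U s)}"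

lemma finite_substrings:
  assumes "finite A"
  shows "finite (substrings l A)"
proof (rule finite_subset)
  show "substrings l A \<subseteq> (\<Union>s\<in>A. set (sublists s))"
    unfolding substrings_def set_sublists_eq by blast
qed (use assms in simp)

lemma substrings_insert: "substrings l (insert s A) = substrings l {s} \<union> substrings l A"
  by (auto simp: substrings_def)

text \<open>A substring of \<open>p @ concat ps\<close> that lies in neither part straddles the
  boundary and is determined by the number of its letters in \<open>p\<close>. So each symbol adds
  at most \<open>l + 1\<close>, hence at most \<open>2 * l\<close>, substrings.\<close>

lemma card_substrings_concat:
  assumes "finite A" "set ps \<subseteq> A" "0 < l"
  shows "card (substrings l (insert (concat ps) A)) \<le> card (substrings l A) + 2 * length ps * l"
  using assms(2)
proof (induction ps)
  case Nil
  have "substrings l {[]} = ({} :: 'a list set)" using assms(3) by (auto simp: substrings_def)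
  then show ?case by (subst substrings_insert) simp
next
  case (Cons p ps)
  define cross where "cross = (\<lambda>k. drop (length p - k) p @ take (l - k) (concat ps)) ` {..l}"
  have "substrings l (insert (concat (p # ps)) A) \<subseteq> substrings l (insert (concat ps) A) \<union> cross"
  proof
    fix U assume "U \<in> substrings l (insert (concat (p # ps)) A)"
    then have U: "length U = l" "sublist U (p @ concat ps) \<or> (\<exists>s\<in>A. sublist U s)"
      by (auto simp: substrings_def)
    show "U \<in> substrings l (insert (concat ps) A) \<union> cross"
    proof (cases "sublist U (concat ps) \<or> (\<exists>s\<in>A. sublist U s)")
      case False
      then have "\<not> sublist U p" using Cons.prems by auto
      with False U obtain xs1 xs2 where "U = xs1 @ xs2" "suffix xs1 p" "prefix xs2 (concat ps)"
        by (auto simp: sublist_append)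
      then have "U = drop (length p - length xs1) p @ take (l - length xs1) (concat ps)" "length xs1 \<le> l"
        using U(1) by (auto simp: suffix_def prefix_def)
      then show ?thesis unfolding cross_def by blast
    qed (use U in \<open>auto simp: substrings_def\<close>)
  qed
  then have "card (substrings l (insert (concat (p # ps)) A))
      \<le> card (substrings l (insert (concat ps) A) \<union> cross)"
    using assms(1) by (intro card_mono) (auto simp: finite_substrings cross_def)
  also have "\<dots> \<le> card (substrings l (insert (concat ps) A)) + card cross"
    by (rule card_Un_le)
  also have "card cross \<le> 2 * l"
  proof -
    have "card cross \<le> card {..l}" unfolding cross_def by (intro card_image_le) simp
    then show ?thesis using assms(3) by simp
  qed
  finally show ?case using Cons by simp
qed

text \<open>A straight-line grammar is represented by the set of expansions of its symbols; its size counts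
  the symbols on the right-hand sides.\<close>

inductive grammar :: "bool list set \<Rightarrow> nat \<Rightarrow> bool" where
  letters: "grammar {[False], [True]} 0"
| rule: "grammar A g \<Longrightarrow> set ps \<subseteq> A \<Longrightarrow> grammar (insert (concat ps) A) (g + length ps)"

lemma grammar_finite: "grammar A g \<Longrightarrow> finite A"
  by (induction rule: grammar.induct) auto

lemma grammar_letter: "grammar A g \<Longrightarrow> [c] \<in> A"
  by (induction rule: grammar.induct) (cases c; auto)+

lemma card_substrings_grammar:
  assumes "grammar A g" "0 < l"
  shows "card (substrings l A) \<le> 2 + 2 * g * l"
  using assms(1)
proof (induction rule: grammar.induct)
  case letters
  have "substrings l {[False], [True]} \<subseteq> {[False], [True]}"
  proof
    fix U assume "U \<in> substrings l {[False], [True]}"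
    then have "U \<noteq> []" "sublist U [False] \<or> sublist U [True]"
      using assms(2) by (auto simp: substrings_def)
    then show "U \<in> {[False], [True]}" by (cases U) (auto simp: sublist_Cons_right)
  qed
  then have "card (substrings l {[False], [True]}) \<le> card {[False], [True]}"
    by (intro card_mono) auto
  then show ?case by simp
next
  case (rule A g ps)
  then show ?case
    using card_substrings_concat[OF grammar_finite[OF rule(1)] rule(2) assms(2)]
    by (simp add: algebra_simps)
qed

lemma grammar_substring_complexity:
  assumes "grammar A g" "T \<in> A" "T \<noteq> []"
  shows "substring_complexity T \<le> 2 + 2 * real g"
proof -
  have "real (num_substrings l T) / real l \<le> 2 + 2 * real g" if l: "l \<in> {1..length T}" for l
  proof -
    have "num_substrings l T \<le> card (substrings l A)"
      unfolding num_substrings_def using assms grammar_finite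
      by (intro card_mono finite_substrings) (auto simp: substrings_def)
    also have "\<dots> \<le> (2 + 2 * g) * l"
      using card_substrings_grammar[OF assms(1), of l] l by (simp add: algebra_simps)
    finally have "real (num_substrings l T) \<le> real ((2 + 2 * g) * l)" by (simp only: of_nat_le_iff)
    also have "\<dots> = (2 + 2 * real g) * real l" by (simp add: algebra_simps)
    finally show ?thesis using l by (intro pos_divide_le_eq[THEN iffD2]) auto
  qed
  then show ?thesis
    using assms(3) unfolding substring_complexity_def by (subst Max_le_iff) (auto simp: Suc_le_eq)
qed

lemma grammar_append:
  "grammar A g \<Longrightarrow> u \<in> A \<Longrightarrow> v \<in> A \<Longrightarrow> grammar (insert (u @ v) A) (g + 2)"
  using grammar.rule[of A g "[u, v]"] by simp

section \<open>Texts for longest common extension queries\<close>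

lemma length_concat_same:
  assumes "\<And>v. v < b \<Longrightarrow> length (g v) = m"
  shows "length (concat (map g [0..<b])) = b * m"
  using assms by (induction b) auto

lemma nth_concat_same:
  assumes "\<And>v. v < b \<Longrightarrow> length (g v) = m" "v < b" "k < m"
  shows "concat (map g [0..<b]) ! (v * m + k) = g v ! k"
  using assms
proof (induction b)
  case (Suc b)
  have len: "length (concat (map g [0..<b])) = b * m" using Suc.prems by (intro length_concat_same) auto
  show ?case
  proof (cases "v = b")
    case False
    then have "v < b" using Suc.prems by simp
    then have "v * m + k < b * m"
      using Suc.prems(3) mult_le_mono1[of "Suc v" b m] by simp
    then show ?thesis using Suc \<open>v < b\<close> len by (simp add: nth_append)
  qed (simp add: nth_append len)
qed simp

text \<open>The query arguments may depend on \<open>x\<close> but not on \<open>F\<close>, so all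
  information about \<open>F\<close> comes from memory. Answers strictly below \<open>n\<close>
  survive the reduction modulo \<open>2 ^ w\<close> even when \<open>n = 2 ^ w\<close>.\<close>

definition hard_texts ::
  "query_type \<Rightarrow> nat \<Rightarrow> nat \<Rightarrow> nat \<Rightarrow> ((nat \<times> nat) set \<Rightarrow> bool list) \<Rightarrow> bool" where
  "hard_texts q d B n T \<longleftrightarrow> (\<exists>args. \<forall>x\<in>queries d B. args x \<in> query_args q n \<and>
     (\<forall>F G. F \<subseteq> {..<d} \<times> {..<B} \<longrightarrow> G \<subseteq> {..<d} \<times> {..<B} \<longrightarrow>
        query_answer q (T F) (args x) < n \<and>
        (query_answer q (T F) (args x) = query_answer q (T G) (args x) \<longrightarrow> digit_parity d F x = digit_parity d G x)))"

text \<open>This is the truth table of the parity, complemented if \<open>b\<close> holds, with the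
  digit sequences in the order of their \<open>radix\<close> values. The accumulator
  \<open>b\<close> carries the parity of the digits already fixed.\<close>

fun parity_string :: "nat \<Rightarrow> (nat \<times> nat) set \<Rightarrow> bool \<Rightarrow> nat \<Rightarrow> bool list" where
  "parity_string B F b 0 = [b]"
| "parity_string B F b (Suc j) =
     concat (map (\<lambda>v. parity_string B F (b \<noteq> ((j, v) \<in> F)) j) [0..<B])"

lemma length_parity_string: "length (parity_string B F b j) = B ^ j"
  by (induction j arbitrary: b) (simp_all add: length_concat_same)

primrec radix :: "nat \<Rightarrow> (nat \<Rightarrow> nat) \<Rightarrow> nat \<Rightarrow> nat" where
  "radix B x 0 = 0"
| "radix B x (Suc j) = x j * B ^ j + radix B x j"

lemma radix_less: "(\<And>i. i < j \<Longrightarrow> x i < B) \<Longrightarrow> radix B x j < B ^ j"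
proof (induction j)
  case (Suc j)
  have "radix B x j < B ^ j" "Suc (x j) \<le> B" using Suc by (auto simp: Suc_le_eq)
  then have "radix B x (Suc j) < Suc (x j) * B ^ j" by simp
  also have "\<dots> \<le> B ^ Suc j" using \<open>Suc (x j) \<le> B\<close> by (simp only: power_Suc mult_le_mono1)
  finally show ?case .
qed simp

lemma parity_string_nth:
  assumes "\<And>i. i < j \<Longrightarrow> x i < B"
  shows "parity_string B F b j ! radix B x j = (b \<noteq> digit_parity j F x)"
  using assms
proof (induction j arbitrary: b)
  case (Suc j)
  have "parity_string B F b (Suc j) ! radix B x (Suc j)
      = parity_string B F (b \<noteq> ((j, x j) \<in> F)) j ! radix B x j"
    using Suc.prems radix_less[of j x B]
    by (simp only: parity_string.simps radix.simps) (subst nth_concat_same[where m = "B ^ j"]; simp add: length_parity_string)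
  then show ?case using Suc by auto
qed simp

text \<open>Only two different strings occur per level, one for each value of \<open>b\<close>, and
  each is a concatenation of \<open>B\<close> strings of the level below.\<close>

lemma grammar_parity_string:
  "\<exists>A. grammar A (2 * j * B) \<and> (\<forall>b. parity_string B F b j \<in> A)"
proof (induction j)
  case 0
  then show ?case using grammar.letters by (intro exI[of _ "{[False], [True]}"]) auto
next
  case (Suc j)
  then obtain A where A: "grammar A (2 * j * B)" "\<And>b. parity_string B F b j \<in> A" by auto
  let ?ps = "\<lambda>b. map (\<lambda>v. parity_string B F (b \<noteq> ((j, v) \<in> F)) j) [0..<B]"
  let ?A' = "insert (concat (?ps False)) A"
  have "grammar ?A' (2 * j * B + B)"
    using grammar.rule[OF A(1), of "?ps False"] A(2) by auto
  then have "grammar (insert (concat (?ps True)) ?A') (2 * j * B + B + B)"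
    using grammar.rule[of ?A' "2 * j * B + B" "?ps True"] A(2) by auto
  moreover have "parity_string B F b (Suc j) \<in> insert (concat (?ps True)) ?A'" for b
    by (cases b) auto
  ultimately show ?case by (intro exI[of _ "insert (concat (?ps True)) ?A'"]) (simp add: algebra_simps)
qed

lemma longest_common_prefix_Cons_Nil: "length (longest_common_prefix (a # xs) [b]) = of_bool (a = b)"
  by (cases xs) auto

lemma suffix_at_drop: "1 \<le> i \<Longrightarrow> suffix_at T i = drop (i - 1) T"
  by (simp add: substr_def)

text \<open>The second argument is the position of the final \<open>True\<close>. Its suffix is a
  single letter, so the extension has length 1 or 0 according to the letter at the first argument,
  which is the parity.\<close>

lemma hard_texts_LCE:
  assumes "2 \<le> B"
  shows "hard_texts LCE_Query d B (Suc (B ^ d)) (\<lambda>F. parity_string B F False d @ [True])"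
  unfolding hard_texts_def
proof (intro exI[of _ "\<lambda>x. [Suc (radix B x d), Suc (B ^ d)]"] ballI conjI allI impI)
  fix x F G assume x: "x \<in> queries d B"
  have r: "radix B x d < B ^ d" using x by (intro radix_less) auto
  have "LCE (parity_string B F False d @ [True]) (Suc (radix B x d)) (Suc (B ^ d)) = of_bool (digit_parity d F x)" for F
  proof -
    let ?T = "parity_string B F False d @ [True]"
    have "drop (radix B x d) ?T = ?T ! radix B x d # drop (Suc (radix B x d)) ?T"
      using r by (intro Cons_nth_drop_Suc[symmetric]) (simp add: length_parity_string)
    moreover have "?T ! radix B x d = digit_parity d F x"
      using parity_string_nth[of d x B F False] x r by (auto simp: nth_append length_parity_string)
    ultimately show ?thesis
      unfolding LCE_def suffix_at_drop[of "Suc _", simplified]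
      by (simp add: length_parity_string longest_common_prefix_Cons_Nil)
  qed
  note LCE = this
  show "[Suc (radix B x d), Suc (B ^ d)] \<in> query_args LCE_Query (Suc (B ^ d))" using r by auto
  show "query_answer LCE_Query (parity_string B F False d @ [True]) [Suc (radix B x d), Suc (B ^ d)] < Suc (B ^ d)"
    using assms by (simp add: LCE)
  assume "query_answer LCE_Query (parity_string B F False d @ [True]) [Suc (radix B x d), Suc (B ^ d)] =
    query_answer LCE_Query (parity_string B G False d @ [True]) [Suc (radix B x d), Suc (B ^ d)]"
  then show "digit_parity d F x = digit_parity d G x" by (auto simp: LCE of_bool_def split: if_splits)
qed

section \<open>Texts for suffix array, inverse suffix array and LCP queries\<close>

text \<open>A leaf \<open>0\<^bsup>A\<^esup>\<close> at the digits \<open>p\<close> of a tower is followed by the codes of \<open>\<sigma> 0 (p 0)\<close>,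
  \<open>\<sigma> 1 (p 1)\<close>, \<open>\<dots>\<close>, separated by strings that depend only on the digits already read.  So
  the leaf suffixes are sorted by these digits, the one of level 0 being the most significant.  They
  precede all other suffixes, since the run \<open>0\<^bsup>A\<^esup>\<close> occurs only in leaves.\<close>

definition digit_code :: "nat \<Rightarrow> nat \<Rightarrow> bool list" where
  "digit_code A u = True # replicate (A - 1 - u) False @ replicate u True @ [True]"

fun tower :: "nat \<Rightarrow> (nat \<Rightarrow> nat \<Rightarrow> nat) \<Rightarrow> nat \<Rightarrow> bool list" where
  "tower A \<sigma> 0 = replicate A False"
| "tower A \<sigma> (Suc j) = concat (map (\<lambda>v. tower A \<sigma> j @ digit_code A (\<sigma> j v)) [0..<A])"

fun tower_length :: "nat \<Rightarrow> nat \<Rightarrow> nat" where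
  "tower_length A 0 = A"
| "tower_length A (Suc j) = A * (tower_length A j + Suc A)"

primrec offset :: "nat \<Rightarrow> (nat \<Rightarrow> nat) \<Rightarrow> nat \<Rightarrow> nat" where
  "offset A p 0 = 0"
| "offset A p (Suc j) = p j * (tower_length A j + Suc A) + offset A p j"

text \<open>In this Horner form digit 0 is the most significant, opposite to \<open>offset\<close>:
  the code read first after a leaf is that of level 0.\<close>

primrec digit_rank :: "nat \<Rightarrow> (nat \<Rightarrow> nat) \<Rightarrow> nat \<Rightarrow> nat" where
  "digit_rank A x 0 = 0"
| "digit_rank A x (Suc j) = digit_rank A x j * A + x j"

section \<open>Order and common prefixes of digit codes\<close>

lemma length_digit_code: "u < A \<Longrightarrow> length (digit_code A u) = Suc A"
  by (simp add: digit_code_def)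

text \<open>After the leading \<open>True\<close>, the run of zeros is shorter for the greater
  digit, so the first mismatch is where that run ends.\<close>

lemma digit_code_split:
  assumes "u < u'" "u' < A"
  obtains s s' where
    "digit_code A u = (True # replicate (A - 1 - u') False) @ False # s"
    "digit_code A u' = (True # replicate (A - 1 - u') False) @ True # s'"
proof
  have "A - 1 - u = (A - 1 - u') + Suc (u' - u - 1)" using assms by simp
  then have "replicate (A - 1 - u) False =
      replicate (A - 1 - u') False @ False # replicate (u' - u - 1) False"
    by (simp only: replicate_add replicate_Suc)
  then show "digit_code A u = (True # replicate (A - 1 - u') False) @ False #
      (replicate (u' - u - 1) False @ replicate u True @ [True])"
    by (simp add: digit_code_def)
  show "digit_code A u' = (True # replicate (A - 1 - u') False) @ True # replicate u' True"
    by (simp add: digit_code_def replicate_append_same)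
qed

lemma lex_less_digit_code:
  assumes "u < u'" "u' < A"
  shows "lex_less (pre @ digit_code A u @ r) (pre @ digit_code A u' @ r')"
proof -
  obtain s s' where
    "digit_code A u = (True # replicate (A - 1 - u') False) @ False # s"
    "digit_code A u' = (True # replicate (A - 1 - u') False) @ True # s'"
    using digit_code_split[OF assms] .
  then have "pre @ digit_code A u @ r = (pre @ True # replicate (A - 1 - u') False) @ False # (s @ r)"
    "pre @ digit_code A u' @ r' = (pre @ True # replicate (A - 1 - u') False) @ True # (s' @ r')"
    by simp_all
  then show ?thesis
    unfolding lex_less_def by (simp only:) (rule lexord_append_left_rightI, simp)
qed

lemma longest_common_prefix_mismatch:
  "a \<noteq> b \<Longrightarrow> longest_common_prefix (u @ a # x) (u @ b # y) = u"
  by (induction u) auto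

lemma length_lcp_digit_code:
  assumes "u < u'" "u' < A"
  shows "length (longest_common_prefix (pre @ digit_code A u' @ r') (pre @ digit_code A u @ r))
    = length pre + (A - u')"
proof -
  obtain s s' where
    "digit_code A u = (True # replicate (A - 1 - u') False) @ False # s"
    "digit_code A u' = (True # replicate (A - 1 - u') False) @ True # s'"
    using digit_code_split[OF assms] .
  then have "pre @ digit_code A u @ r = (pre @ True # replicate (A - 1 - u') False) @ False # (s @ r)"
    "pre @ digit_code A u' @ r' = (pre @ True # replicate (A - 1 - u') False) @ True # (s' @ r')"
    by simp_all
  then have "longest_common_prefix (pre @ digit_code A u' @ r') (pre @ digit_code A u @ r)
      = pre @ True # replicate (A - 1 - u') False"
    by (simp only: longest_common_prefix_mismatch[of True False] simp_thms)
  then show ?thesis using assms by simp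
qed

section \<open>Text positions and lexicographic ranks of leaves\<close>

lemma drop_concat_same:
  assumes "\<And>v. v < b \<Longrightarrow> length (g v) = m" "v < b" "k \<le> m"
  shows "drop (v * m + k) (concat (map g [0..<b])) = drop k (g v) @ concat (map g [Suc v..<b])"
proof -
  have "[0..<b] = [0..<v] @ v # [Suc v..<b]"
    using upt_add_eq_append[of 0 v "b - v"] upt_conv_Cons[OF assms(2)] assms(2) by simp
  moreover have "length (concat (map g [0..<v])) = v * m"
    using assms by (intro length_concat_same) auto
  ultimately show ?thesis using assms by simp
qed

lemma offset_bound:
  assumes "\<And>i. i < j \<Longrightarrow> p i < A"
  shows "offset A p j + A \<le> tower_length A j"
  using assms
proof (induction j)
  case (Suc j)
  let ?m = "tower_length A j + Suc A"
  have "offset A p j + A \<le> tower_length A j" "Suc (p j) \<le> A" using Suc by (auto simp: Suc_le_eq)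
  then have "offset A p (Suc j) + A \<le> Suc (p j) * ?m" by simp
  also have "\<dots> \<le> A * ?m" using \<open>Suc (p j) \<le> A\<close> by (rule mult_le_mono1)
  finally show ?case by simp
qed simp

lemma offset_cong: "(\<And>i. i < j \<Longrightarrow> p i = q i) \<Longrightarrow> offset A p j = offset A q j"
  by (induction j) auto

lemma offset_inj:
  assumes "\<And>i. i < j \<Longrightarrow> p i < A" "\<And>i. i < j \<Longrightarrow> q i < A" "offset A p j = offset A q j" "i < j"
  shows "p i = q i"
  using assms
proof (induction j)
  case (Suc j)
  let ?m = "tower_length A j + Suc A"
  have "offset A p j + A \<le> tower_length A j" "offset A q j + A \<le> tower_length A j"
    using Suc.prems by (auto intro!: offset_bound)
  then have less: "offset A p j < ?m" "offset A q j < ?m" by auto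
  have eq: "p j * ?m + offset A p j = q j * ?m + offset A q j" using Suc.prems(3) by simp
  have "p j = (p j * ?m + offset A p j) div ?m" using less by (subst div_mult_self3) auto
  also have "\<dots> = q j" unfolding eq using less by (subst div_mult_self3) auto
  finally have pj: "p j = q j" .
  then have "offset A p j = offset A q j" using eq by simp
  then show ?case using Suc pj by (cases "i = j") auto
qed simp

lemma digit_rank_less: "(\<And>i. i < j \<Longrightarrow> x i < A) \<Longrightarrow> digit_rank A x j < A ^ j"
proof (induction j)
  case (Suc j)
  have "Suc (digit_rank A x j) \<le> A ^ j" "x j < A" using Suc by (auto simp: Suc_le_eq)
  then have "digit_rank A x (Suc j) < Suc (digit_rank A x j) * A" by simp
  also have "\<dots> \<le> A ^ j * A" using \<open>Suc _ \<le> _\<close> by (rule mult_le_mono1)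
  finally show ?case by (simp add: mult.commute)
qed simp

lemma digit_rank_inj:
  assumes "\<And>i. i < D \<Longrightarrow> x i < A" "\<And>i. i < D \<Longrightarrow> y i < A" "digit_rank A x D = digit_rank A y D" "i < D"
  shows "x i = y i"
  using assms
proof (induction D)
  case (Suc D)
  then have "x D < A" "y D < A" by auto
  have eq: "digit_rank A x D * A + x D = digit_rank A y D * A + y D" using Suc.prems by simp
  have "digit_rank A x D = (digit_rank A x D * A + x D) div A" using \<open>x D < A\<close> by simp
  also have "\<dots> = digit_rank A y D" unfolding eq using \<open>y D < A\<close> by simp
  finally show ?case using Suc eq by (metis add_left_cancel less_Suc_eq)
qed simp

text \<open>Numerical order of Horner values is lexicographic order of digits, level 0 first. The
  last digit matters only when the values of the preceding digits are equal.\<close>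

lemma digit_rank_less_imp:
  assumes "\<And>i. i < D \<Longrightarrow> x i < A" "\<And>i. i < D \<Longrightarrow> y i < A" "digit_rank A x D < digit_rank A y D"
  shows "\<exists>j<D. (\<forall>i<j. x i = y i) \<and> x j < y j"
  using assms
proof (induction D)
  case (Suc D)
  let ?r = "digit_rank A x D" and ?s = "digit_rank A y D"
  have less: "x D < A" "y D < A" using Suc.prems by auto
  show ?case
  proof (cases "?r < ?s")
    case True
    then show ?thesis using Suc by (metis less_Suc_eq)
  next
    case False
    have "\<not> ?s < ?r"
    proof
      assume "?s < ?r"
      then have "Suc ?s * A \<le> ?r * A" by (intro mult_le_mono1) auto
      then show False using Suc.prems(3) less by simp
    qed
    then have eq: "?r = ?s" using False by simp
    have "x i = y i" if "i < D" for i
      using digit_rank_inj[OF _ _ eq that] Suc.prems(1,2) by simp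
    then show ?thesis using eq Suc.prems(3) by auto
  qed
qed simp

lemma digit_rank_surj:
  assumes "r < A ^ D"
  shows "\<exists>x. (\<forall>i<D. x i < A) \<and> digit_rank A x D = r"
  using assms
proof (induction D arbitrary: r)
  case (Suc D)
  have "0 < A" using Suc.prems by (cases A) auto
  have "r div A < A ^ D"
    using Suc.prems \<open>0 < A\<close> by (simp add: less_mult_imp_div_less mult.commute)
  then obtain x where x: "\<forall>i<D. x i < A" "digit_rank A x D = r div A" using Suc.IH by blast
  have "digit_rank A (x(D := r mod A)) k = digit_rank A x k" if "k \<le> D" for k
    using that by (induction k) auto
  then have "digit_rank A (x(D := r mod A)) (Suc D) = r" using x(2) by simp
  moreover have "\<forall>i<Suc D. (x(D := r mod A)) i < A" using x(1) \<open>0 < A\<close> by auto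
  ultimately show ?case by blast
qed simp

text \<open>This determines an initial segment of the suffix array without knowing the rest. The
  suffixes up to the one at \<open>g i\<close> are counted twice: \<open>i\<close> by the
  enumeration \<open>g\<close>, and \<open>i'\<close> by the suffix array, where \<open>i'\<close>
  is the index of \<open>g i\<close> in it.\<close>

lemma SA_eqI:
  fixes T :: "'a::linorder list"
  assumes range: "\<And>i. i \<in> {1..m} \<Longrightarrow> g i \<in> {1..length T}"
    and mono: "\<And>i j. i \<in> {1..m} \<Longrightarrow> j \<in> {1..m} \<Longrightarrow> i < j \<Longrightarrow>
      lex_less (suffix_at T (g i)) (suffix_at T (g j))"
    and rest: "\<And>i k. i \<in> {1..m} \<Longrightarrow> k \<in> {1..length T} \<Longrightarrow> k \<notin> g ` {1..m} \<Longrightarrow>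
      lex_less (suffix_at T (g i)) (suffix_at T k)"
    and i: "i \<in> {1..m}"
  shows "SA T i = g i"
proof -
  let ?I = "{1..length T}"
  have sa: "is_suffix_array T (SA T)" unfolding SA_def by (rule theI'[OF ex1_is_suffix_array])
  then have perm: "SA T permutes ?I" by (simp add: is_suffix_array_def)
  have sa_mono: "lex_less (suffix_at T (SA T i)) (suffix_at T (SA T j))"
    if "i \<in> ?I" "j \<in> ?I" "i < j" for i j
    using sa that by (auto simp: is_suffix_array_def)
  define i' where "i' = inv (SA T) (g i)"
  have i': "SA T i' = g i" "i' \<in> ?I"
    using permutes_inverses[OF perm] permutes_in_image[OF permutes_inv[OF perm]] range[OF i]
    by (auto simp: i'_def)
  let ?S = "{k \<in> ?I. k = g i \<or> lex_less (suffix_at T k) (suffix_at T (g i))}"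
  have asym: "\<not> lex_less (suffix_at T k) (suffix_at T l)" if "lex_less (suffix_at T l) (suffix_at T k)" for k l
    using that lex_less_irrefl lex_less_trans by blast
  have "?S = g ` {1..i}"
  proof (intro equalityI subsetI)
    fix k assume k: "k \<in> ?S"
    then have "k \<in> g ` {1..m}" using rest[OF i, of k] asym i by blast
    then obtain j where j: "j \<in> {1..m}" "k = g j" by auto
    have "j \<le> i"
    proof (rule ccontr)
      assume "\<not> j \<le> i"
      then have l: "lex_less (suffix_at T (g i)) (suffix_at T (g j))" using mono[OF i j(1)] by simp
      then have "g j \<noteq> g i" using lex_less_irrefl by metis
      then show False using k j asym[OF l] by auto
    qed
    then show "k \<in> g ` {1..i}" using j by auto
  next
    fix k assume "k \<in> g ` {1..i}"
    then obtain j where j: "1 \<le> j" "j \<le> i" "k = g j" by auto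
    then show "k \<in> ?S" using mono[of j i] range[of j] i by (cases "j = i") auto
  qed
  moreover have "inj_on g {1..i}"
  proof (rule inj_onI)
    fix a b assume "a \<in> {1..i}" "b \<in> {1..i}" "g a = g b"
    then show "a = b"
      using mono[of a b] mono[of b a] i lex_less_irrefl by (metis atLeastAtMost_iff le_trans linorder_neqE_nat)
  qed
  ultimately have "card ?S = i" by (simp add: card_image)
  have "?S = SA T ` {1..i'}"
  proof (intro equalityI subsetI)
    fix k assume k: "k \<in> ?S"
    obtain j where j: "k = SA T j" using permutes_surj[OF perm] by (metis surjD)
    have jI: "j \<in> ?I" using k j permutes_in_image[OF perm] by auto
    have "j \<le> i'"
    proof (rule ccontr)
      assume "\<not> j \<le> i'"
      then have l: "lex_less (suffix_at T (SA T i')) (suffix_at T (SA T j))" using sa_mono[OF i'(2) jI] by simp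
      then have "SA T j \<noteq> SA T i'" using lex_less_irrefl by metis
      then show False using k j asym[OF l] i' by auto
    qed
    then show "k \<in> SA T ` {1..i'}" using j jI by auto
  next
    fix k assume "k \<in> SA T ` {1..i'}"
    then obtain j where j: "1 \<le> j" "j \<le> i'" "k = SA T j" by auto
    then have "j \<in> ?I" using i' by auto
    then have "k \<in> ?I" using permutes_in_image[OF perm, of j] j(3) by simp
    moreover have "k = g i \<or> lex_less (suffix_at T k) (suffix_at T (g i))"
      using sa_mono[OF \<open>j \<in> ?I\<close> i'(2)] j(2,3) unfolding i'(1)[symmetric]
      by (cases "j = i'") simp_all
    ultimately show "k \<in> ?S" by simp
  qed
  then have "card ?S = i'" using permutes_inj[OF perm] by (simp add: card_image inj_on_subset)
  then show ?thesis using \<open>card ?S = i\<close> i'(1) by simp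
qed

section \<open>Sorted suffixes of a tower with permuted digits\<close>

locale digit_tower =
  fixes A :: nat and \<sigma> :: "nat \<Rightarrow> nat \<Rightarrow> nat"
  assumes A_ge: "2 \<le> A"
    and \<sigma>_less: "v < A \<Longrightarrow> \<sigma> j v < A"
    and \<sigma>_invol: "v < A \<Longrightarrow> \<sigma> j (\<sigma> j v) = v"
begin

lemma length_block: "v < A \<Longrightarrow> length xs = m \<Longrightarrow> length (xs @ digit_code A (\<sigma> j v)) = m + Suc A"
  using length_digit_code[OF \<sigma>_less, of v j] by simp

lemma length_tower: "length (tower A \<sigma> j) = tower_length A j"
proof (induction j)
  case (Suc j)
  then show ?case
    using length_concat_same[of A "\<lambda>v. tower A \<sigma> j @ digit_code A (\<sigma> j v)" "tower_length A j + Suc A"]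
      length_block[of _ "tower A \<sigma> j" "tower_length A j" j] by simp
qed simp

lemma tower_nth:
  assumes "v < A" "k < tower_length A j + Suc A"
  shows "tower A \<sigma> (Suc j) ! (v * (tower_length A j + Suc A) + k)
    = (tower A \<sigma> j @ digit_code A (\<sigma> j v)) ! k"
  unfolding tower.simps
  using assms by (intro nth_concat_same length_block length_tower) auto

lemma drop_offset_Suc:
  assumes "\<And>i. i \<le> j \<Longrightarrow> p i < A"
  shows "\<exists>rest. drop (offset A p (Suc j)) (tower A \<sigma> (Suc j))
    = drop (offset A p j) (tower A \<sigma> j) @ digit_code A (\<sigma> j (p j)) @ rest"
proof -
  have "offset A p j + A \<le> tower_length A j" using assms by (intro offset_bound) auto
  then have o: "offset A p j \<le> tower_length A j" "offset A p j \<le> tower_length A j + Suc A" by auto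
  show ?thesis
    unfolding tower.simps offset.simps
    using assms o by (subst drop_concat_same[OF length_block[OF _ length_tower]]) (auto simp: length_tower)
qed

lemma drop_offset:
  assumes "\<And>i. i < D \<Longrightarrow> p i < A" "j < D"
  shows "\<exists>rest. drop (offset A p D) (tower A \<sigma> D)
    = drop (offset A p j) (tower A \<sigma> j) @ digit_code A (\<sigma> j (p j)) @ rest"
proof -
  have "Suc j \<le> D" using assms(2) by simp
  then show ?thesis
    using assms(1)
  proof (induction D rule: dec_induct)
    case base
    then show ?case by (intro drop_offset_Suc) auto
  next
    case (step D)
    obtain r where "drop (offset A p D) (tower A \<sigma> D)
        = drop (offset A p j) (tower A \<sigma> j) @ digit_code A (\<sigma> j (p j)) @ r"
      using step by (metis less_SucI)
    moreover obtain r' where "drop (offset A p (Suc D)) (tower A \<sigma> (Suc D))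
        = drop (offset A p D) (tower A \<sigma> D) @ digit_code A (\<sigma> D (p D)) @ r'"
      using drop_offset_Suc[of D p] step.prems by auto
    ultimately show ?case by simp
  qed
qed

text \<open>As \<open>\<sigma> i\<close> is its own inverse, the leaf at the digits
  \<open>\<sigma> i (x i)\<close> is followed by the codes of \<open>x 0\<close>,
  \<open>x 1\<close>, and so on. Up to the first differing digit both offsets are equal, hence so
  are the strings read, and the codes of that digit decide.\<close>

lemma lex_less_leaves:
  assumes x: "\<And>i. i < D \<Longrightarrow> x i < A" and y: "\<And>i. i < D \<Longrightarrow> y i < A"
    and less: "digit_rank A x D < digit_rank A y D"
  shows "lex_less (drop (offset A (\<lambda>i. \<sigma> i (x i)) D) (tower A \<sigma> D))
    (drop (offset A (\<lambda>i. \<sigma> i (y i)) D) (tower A \<sigma> D))"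
proof -
  obtain j where j: "j < D" "\<And>i. i < j \<Longrightarrow> x i = y i" "x j < y j"
    using digit_rank_less_imp[OF x y less] by auto
  obtain r where r: "drop (offset A (\<lambda>i. \<sigma> i (x i)) D) (tower A \<sigma> D) =
      drop (offset A (\<lambda>i. \<sigma> i (x i)) j) (tower A \<sigma> j) @ digit_code A (\<sigma> j (\<sigma> j (x j))) @ r"
    using drop_offset[of D "\<lambda>i. \<sigma> i (x i)" j] x \<sigma>_less j(1) by blast
  obtain r' where r': "drop (offset A (\<lambda>i. \<sigma> i (y i)) D) (tower A \<sigma> D) =
      drop (offset A (\<lambda>i. \<sigma> i (y i)) j) (tower A \<sigma> j) @ digit_code A (\<sigma> j (\<sigma> j (y j))) @ r'"
    using drop_offset[of D "\<lambda>i. \<sigma> i (y i)" j] y \<sigma>_less j(1) by blast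
  have "offset A (\<lambda>i. \<sigma> i (x i)) j = offset A (\<lambda>i. \<sigma> i (y i)) j"
    using j by (intro offset_cong) auto
  then show ?thesis
    unfolding r r' using j x y by (simp add: \<sigma>_invol lex_less_digit_code)
qed

lemma leaf_prefix:
  assumes "\<And>i. i < D \<Longrightarrow> p i < A" "0 < D"
  shows "\<exists>rest. drop (offset A p D) (tower A \<sigma> D) = replicate A False @ rest"
  using drop_offset[of D p 0] assms by auto

text \<open>A position that does not start a leaf has a \<open>True\<close> among the
  \<open>A\<close> letters from it on, so its suffix cannot begin with the run of a leaf. The
  hypothesis may use an appended \<open>True\<close>, since a code starts with that letter; the
  conclusion needs none, since the higher tower ends with a code.\<close>

lemma tower_True_or_leaf_Suc:
  assumes IH: "\<And>k. k < tower_length A j \<Longrightarrow> (\<exists>p. (\<forall>i<j. p i < A) \<and> k = offset A p j) \<or>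
      (\<exists>i<A. k + i \<le> tower_length A j \<and> (tower A \<sigma> j @ [True]) ! (k + i))"
    and k: "k < tower_length A (Suc j)"
  shows "(\<exists>p. (\<forall>i<Suc j. p i < A) \<and> k = offset A p (Suc j)) \<or>
      (\<exists>i<A. k + i < tower_length A (Suc j) \<and> tower A \<sigma> (Suc j) ! (k + i))"
proof -
  let ?m = "tower_length A j + Suc A"
  define v where "v = k div ?m"
  define k' where "k' = k mod ?m"
  have kv: "k = v * ?m + k'" unfolding v_def k'_def by (rule div_mult_mod_eq[symmetric])
  have k'm: "k' < ?m" by (simp add: k'_def)
  have vA: "v < A" using k by (simp add: v_def less_mult_imp_div_less)
  have code: "length (digit_code A (\<sigma> j v)) = Suc A" using vA by (simp add: length_digit_code \<sigma>_less)
  have hit: ?thesis if "k' + i < ?m" "i < A" "(tower A \<sigma> j @ digit_code A (\<sigma> j v)) ! (k' + i)" for i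
  proof -
    have eq: "k + i = v * ?m + (k' + i)" by (subst kv) (rule add.assoc)
    have "v * ?m + (k' + i) < Suc v * ?m" using that(1) by simp
    also have "\<dots> \<le> A * ?m" using vA by (intro mult_le_mono1) simp
    finally have "k + i < tower_length A (Suc j)" unfolding eq tower_length.simps .
    moreover have "tower A \<sigma> (Suc j) ! (k + i)"
      unfolding eq tower_nth[OF vA that(1)] by (rule that(3))
    ultimately have "k + i < tower_length A (Suc j) \<and> tower A \<sigma> (Suc j) ! (k + i)" ..
    then show ?thesis using that(2) by blast
  qed
  show ?thesis
  proof (cases "k' < tower_length A j")
    case True
    from IH[OF True] show ?thesis
    proof (elim disjE exE conjE)
      fix p assume p: "\<forall>i<j. p i < A" "k' = offset A p j"
      have "offset A (p(j := v)) j = offset A p j" by (intro offset_cong) auto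
      then have "k = offset A (p(j := v)) (Suc j)" using p kv by simp
      moreover have "\<forall>i<Suc j. (p(j := v)) i < A" using p vA by auto
      ultimately show ?thesis by blast
    next
      fix i assume i: "i < A" "k' + i \<le> tower_length A j" "(tower A \<sigma> j @ [True]) ! (k' + i)"
      then have "(tower A \<sigma> j @ digit_code A (\<sigma> j v)) ! (k' + i)"
        by (cases "k' + i = tower_length A j") (auto simp: nth_append length_tower digit_code_def)
      then show ?thesis using hit[of i] i by auto
    qed
  next
    case False
    show ?thesis
    proof (cases "k' = tower_length A j")
      case True
      then show ?thesis using hit[of 0] A_ge by (simp add: nth_append length_tower digit_code_def)
    next
      case k'_ne: False
      \<comment> \<open>The position is inside the code but past its first letter, so the last
        letter, a \<open>True\<close> at index \<open>A\<close> of the code, is fewer than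
        \<open>A\<close> letters away.\<close>
      define i where "i = tower_length A j + A - k'"
      have "k' + i = tower_length A j + A" "i < A" using False k'_ne k'm by (auto simp: i_def)
      moreover have "digit_code A (\<sigma> j v) ! A"
      proof -
        have "last (digit_code A (\<sigma> j v)) = True" by (simp add: digit_code_def)
        then show ?thesis using code by (metis diff_Suc_1 last_conv_nth list.size(3) nat.distinct(1))
      qed
      ultimately show ?thesis using hit[of i] by (simp add: nth_append length_tower)
    qed
  qed
qed

lemma tower_True_or_leaf:
  assumes "k < tower_length A j"
  shows "(\<exists>p. (\<forall>i<j. p i < A) \<and> k = offset A p j) \<or>
      (\<exists>i<A. k + i \<le> tower_length A j \<and> (tower A \<sigma> j @ [True]) ! (k + i))"
  using assms
proof (induction j arbitrary: k)
  case 0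
  then have "k = 0 \<or> A - k < A" "k + (A - k) = A" using A_ge by auto
  then show ?case by (cases "k = 0") (auto simp: nth_append intro!: exI[of _ "A - k"])
next
  case (Suc j)
  from tower_True_or_leaf_Suc[OF Suc] show ?case
    by (auto simp: nth_append length_tower simp del: tower.simps tower_length.simps offset.simps)
qed

lemma replicate_False_lex_less:
  assumes "i < A" "i < length U" "U ! i"
  shows "lex_less (replicate A False @ rest) U"
proof -
  define l where "l = (LEAST i. U ! i)"
  have l: "U ! l" "l \<le> i" "\<And>k. k < l \<Longrightarrow> \<not> U ! k"
    using assms(3) unfolding l_def by (auto intro: LeastI Least_le dest: not_less_Least)
  have "U = take l U @ True # drop (Suc l) U"
    using id_take_nth_drop[of l U] l assms by auto
  also have "take l U = replicate l False"
    using l assms by (intro nth_equalityI) auto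
  finally have U: "U = replicate l False @ True # drop (Suc l) U" .
  have "A = l + Suc (A - l - 1)" using l assms by simp
  then have "replicate A False @ rest = replicate l False @ False # replicate (A - l - 1) False @ rest"
    by (metis append.assoc append_Cons replicate_Suc replicate_add)
  then show ?thesis
    unfolding lex_less_def by (subst U, simp only:) (rule lexord_append_left_rightI, simp)
qed

text \<open>The leaf suffixes start with \<open>A\<close> zeros and all others have an earlier
  \<open>True\<close>, so the leaves fill the first \<open>A ^ D\<close> entries, in the order of
  their ranks by \<open>lex_less_leaves\<close>.\<close>

lemma SA_tower:
  assumes x: "\<And>i. i < D \<Longrightarrow> x i < A" and "0 < D"
  shows "SA (tower A \<sigma> D) (Suc (digit_rank A x D)) = Suc (offset A (\<lambda>i. \<sigma> i (x i)) D)"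
proof -
  let ?T = "tower A \<sigma> D"
  obtain E where E: "D = Suc E" using \<open>0 < D\<close> by (cases D) auto
  have "\<exists>dig. \<forall>r<A ^ D. (\<forall>i<D. dig r i < A) \<and> digit_rank A (dig r) D = r"
    using digit_rank_surj[of _ A D] by metis
  then obtain dig where dig: "\<And>r i. r < A ^ D \<Longrightarrow> i < D \<Longrightarrow> dig r i < A"
    "\<And>r. r < A ^ D \<Longrightarrow> digit_rank A (dig r) D = r" by blast
  \<comment> \<open>Ranks and offsets count from 0, suffix array indices and text positions from 1;
    \<open>r - 1\<close> and \<open>Suc\<close> convert between them.\<close>
  define g where "g r = Suc (offset A (\<lambda>i. \<sigma> i (dig (r - 1) i)) D)" for r
  have less: "digit_rank A x D < A ^ D" using x by (intro digit_rank_less)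
  have pos_less: "offset A p D < length ?T" if "\<And>i. i < D \<Longrightarrow> p i < A" for p
    using offset_bound[of D p A] that A_ge by (simp add: length_tower)
  have suffix_g: "suffix_at ?T (g r) = drop (offset A (\<lambda>i. \<sigma> i (dig (r - 1) i)) D) ?T" for r
    by (simp add: suffix_at_drop g_def)
  have "SA ?T (Suc (digit_rank A x D)) = g (Suc (digit_rank A x D))"
  proof (rule SA_eqI[where m = "A ^ D"])
    fix i assume "i \<in> {1..A ^ D}"
    then have "i - 1 < A ^ D" by auto
    then show "g i \<in> {1..length ?T}"
      using pos_less[of "\<lambda>j. \<sigma> j (dig (i - 1) j)"] dig \<sigma>_less by (auto simp: g_def Suc_le_eq)
  next
    fix i j assume "i \<in> {1..A ^ D}" "j \<in> {1..A ^ D}" "i < j"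
    then have "i - 1 < A ^ D" "j - 1 < A ^ D" "i - 1 < j - 1" by auto
    then show "lex_less (suffix_at ?T (g i)) (suffix_at ?T (g j))"
      unfolding suffix_g using dig by (intro lex_less_leaves) auto
  next
    fix i k assume i: "i \<in> {1..A ^ D}" and k: "k \<in> {1..length ?T}" "k \<notin> g ` {1..A ^ D}"
    have i1: "i - 1 < A ^ D" using i by auto
    have "\<not> (\<exists>p. (\<forall>i<Suc E. p i < A) \<and> k - 1 = offset A p (Suc E))"
    proof
      assume "\<exists>p. (\<forall>i<Suc E. p i < A) \<and> k - 1 = offset A p (Suc E)"
      then obtain p where p: "\<And>i. i < D \<Longrightarrow> p i < A" "k - 1 = offset A p D" unfolding E by auto
      \<comment> \<open>These are the digits by which the leaf at \<open>p\<close> is sorted, so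
        \<open>g\<close> does reach this leaf, contrary to the choice of \<open>k\<close>.\<close>
      define y where "y i = \<sigma> i (p i)" for i
      have y: "\<And>i. i < D \<Longrightarrow> y i < A" using p \<sigma>_less by (auto simp: y_def)
      have r: "digit_rank A y D < A ^ D" using y by (intro digit_rank_less)
      have "dig (digit_rank A y D) i = y i" if "i < D" for i
        using digit_rank_inj[of D "dig (digit_rank A y D)" A y i] dig r y that by auto
      then have "offset A (\<lambda>i. \<sigma> i (dig (digit_rank A y D) i)) D = offset A p D"
        using p(1) by (intro offset_cong) (auto simp: y_def \<sigma>_invol)
      then have "g (Suc (digit_rank A y D)) = k" using p(2) k(1) by (auto simp: g_def)
      then show False using k(2) r by (auto simp: Suc_le_eq)
    qed
    moreover have "k - 1 < tower_length A (Suc E)" using k(1) by (auto simp: E length_tower[of "Suc E"] simp del: tower.simps tower_length.simps)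
    \<comment> \<open>The form for a successor level finds the \<open>True\<close> within the tower
      itself rather than in an appended letter.\<close>
    ultimately obtain l where l: "l < A" "k - 1 + l < tower_length A (Suc E)" "?T ! (k - 1 + l)"
      using tower_True_or_leaf_Suc[OF tower_True_or_leaf, of E "k - 1"] unfolding E by blast
    obtain rest where "drop (offset A (\<lambda>j. \<sigma> j (dig (i - 1) j)) D) ?T = replicate A False @ rest"
      using leaf_prefix[of D "\<lambda>j. \<sigma> j (dig (i - 1) j)"] dig(1)[OF i1] \<sigma>_less \<open>0 < D\<close> by blast
    moreover have "lex_less (replicate A False @ rest) (drop (k - 1) ?T)"
      using l length_tower[of D] k by (intro replicate_False_lex_less[of l]) (auto simp: E simp del: tower.simps tower_length.simps)
    ultimately show "lex_less (suffix_at ?T (g i)) (suffix_at ?T k)"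
      unfolding suffix_g using k(1) by (simp add: suffix_at_drop)
  qed (use less in \<open>auto simp: Suc_le_eq\<close>)
  also have "\<dots> = Suc (offset A (\<lambda>i. \<sigma> i (x i)) D)"
  proof -
    have "dig (digit_rank A x D) i = x i" if "i < D" for i
      using digit_rank_inj[of D "dig (digit_rank A x D)" A x i] dig less x that by auto
    then show ?thesis unfolding g_def by (auto intro!: offset_cong)
  qed
  finally show ?thesis .
qed

lemma ISA_tower:
  assumes p: "\<And>i. i < D \<Longrightarrow> p i < A" and "0 < D"
  shows "ISA (tower A \<sigma> D) (Suc (offset A p D)) = Suc (digit_rank A (\<lambda>i. \<sigma> i (p i)) D)"
proof -
  let ?T = "tower A \<sigma> D"
  have "is_suffix_array ?T (SA ?T)" unfolding SA_def by (rule theI'[OF ex1_is_suffix_array])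
  then have "inj (SA ?T)" unfolding is_suffix_array_def using permutes_inj by blast
  moreover have "SA ?T (Suc (digit_rank A (\<lambda>i. \<sigma> i (p i)) D)) = Suc (offset A p D)"
    using p \<sigma>_less \<sigma>_invol \<open>0 < D\<close> by (subst SA_tower) (auto intro!: offset_cong)
  ultimately show ?thesis unfolding ISA_def by (metis inv_f_f)
qed

text \<open>The preceding suffix in the order belongs to the leaf that differs only in having top
  digit 0. Both suffixes share what remains of the tower of height \<open>d\<close>, and then the
  \<open>A - 1\<close> letters on which the codes of 1 and 0 agree.\<close>

lemma LCP_tower:
  assumes x: "\<And>i. i < d \<Longrightarrow> x i < A" and top: "x d = 1"
  shows "LCP (tower A \<sigma> (Suc d)) (Suc (digit_rank A x (Suc d)))
    = tower_length A d - offset A (\<lambda>i. \<sigma> i (x i)) d + (A - 1)"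
proof -
  let ?T = "tower A \<sigma> (Suc d)"
  define y where "y = x(d := 0)"
  have xA: "x i < A" "y i < A" if "i < Suc d" for i
    using x top A_ge that by (cases "i = d"; auto simp: y_def)+
  have "digit_rank A y d = digit_rank A x d"
  proof -
    have "digit_rank A y k = digit_rank A x k" if "k \<le> d" for k
      using that by (induction k) (auto simp: y_def)
    then show ?thesis by simp
  qed
  then have rk: "digit_rank A x (Suc d) = Suc (digit_rank A y (Suc d))" using top by (simp add: y_def)
  have off: "offset A (\<lambda>i. \<sigma> i (y i)) d = offset A (\<lambda>i. \<sigma> i (x i)) d"
    by (intro offset_cong) (auto simp: y_def)
  have "offset A (\<lambda>i. \<sigma> i (x i)) d + A \<le> tower_length A d"
    using x \<sigma>_less by (intro offset_bound) auto
  let ?pre = "drop (offset A (\<lambda>i. \<sigma> i (x i)) d) (tower A \<sigma> d)"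
  obtain r where r: "drop (offset A (\<lambda>i. \<sigma> i (x i)) (Suc d)) ?T = ?pre @ digit_code A 1 @ r"
    using drop_offset_Suc[of d "\<lambda>i. \<sigma> i (x i)"] xA \<sigma>_less top \<sigma>_invol[of 1 d] A_ge by auto
  obtain r' where r': "drop (offset A (\<lambda>i. \<sigma> i (y i)) (Suc d)) ?T = ?pre @ digit_code A 0 @ r'"
    using drop_offset_Suc[of d "\<lambda>i. \<sigma> i (y i)"] xA \<sigma>_less \<sigma>_invol[of 0 d] A_ge off by (auto simp: y_def)
  have "LCP ?T (Suc (digit_rank A x (Suc d))) =
      LCE ?T (Suc (offset A (\<lambda>i. \<sigma> i (x i)) (Suc d))) (Suc (offset A (\<lambda>i. \<sigma> i (y i)) (Suc d)))"
    unfolding LCP_def rk using SA_tower[of "Suc d" x] SA_tower[of "Suc d" y] xA rk by simp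
  also have "\<dots> = length ?pre + (A - 1)"
    unfolding LCE_def suffix_at_drop[of "Suc _", simplified] r r'
    using A_ge by (intro length_lcp_digit_code) auto
  finally show ?thesis by (simp add: length_tower)
qed

end

section \<open>Storing a set of pairs in the digit permutations of a tower\<close>

definition pair_swap :: "(nat \<times> nat) set \<Rightarrow> nat \<Rightarrow> nat \<Rightarrow> nat" where
  "pair_swap F j v = (if (j, v div 2) \<in> F then if even v then v + 1 else v - 1 else v)"

lemma pair_swap_double: "pair_swap F j (2 * v) = 2 * v + of_bool ((j, v) \<in> F)"
  by (simp add: pair_swap_def)

text \<open>Exchanging \<open>2 * v\<close> with \<open>2 * v + 1\<close> stores one bit and is an
  involution on digits. This is why a tower uses \<open>2 * B\<close> digits for \<open>B\<close>
  values.\<close>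

lemma digit_tower_pair_swap:
  assumes "1 \<le> B"
  shows "digit_tower (2 * B) (pair_swap F)"
proof
  fix v j assume v: "v < 2 * B"
  show "pair_swap F j v < 2 * B" using v by (auto simp: pair_swap_def elim!: evenE)
  show "pair_swap F j (pair_swap F j v) = v"
    using v by (cases "even v") (auto simp: pair_swap_def elim!: evenE oddE)
qed (use assms in simp)

abbreviation tower_text :: "nat \<Rightarrow> nat \<Rightarrow> (nat \<times> nat) set \<Rightarrow> bool list" where
  "tower_text d B F \<equiv> tower (2 * B) (pair_swap F) (Suc d)"

lemma power_less_tower_length: "2 \<le> A \<Longrightarrow> A ^ j < tower_length A j"
proof (induction j)
  case (Suc j)
  then have "A * A ^ j < A * (tower_length A j + Suc A)" by (intro mult_strict_left_mono) auto
  then show ?case by simp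
qed simp

lemma digit_parity_eq_of_pair_swap_eq:
  assumes "\<And>j. j < d \<Longrightarrow> pair_swap F j (2 * x j) = pair_swap G j (2 * x j)"
  shows "digit_parity d F x = digit_parity d G x"
proof (rule digit_parity_cong)
  fix i assume "i < d"
  from assms[OF this] show "(i, x i) \<in> F \<longleftrightarrow> (i, x i) \<in> G"
    by (simp add: pair_swap_double of_bool_eq_iff)
qed

text \<open>Every answer determines the permuted digits below level \<open>d\<close>: a suffix array
  entry is an offset, an inverse entry is a rank, and an LCP value is a constant minus an offset.
  These digits reveal each membership \<open>(j, x j) \<in> F\<close>, and thus the parity.\<close>

lemma hard_texts_tower:
  assumes B: "1 \<le> B" and q: "q \<noteq> LCE_Query"
  shows "hard_texts q d B (tower_length (2 * B) (Suc d)) (tower_text d B)"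
proof -
  let ?A = "2 * B" and ?n = "tower_length (2 * B) (Suc d)"
  \<comment> \<open>The top digit is 1, so that the preceding leaf in suffix order differs only in the top digit.\<close>
  define dig where "dig x j = (if j < d then 2 * x j else 1)" for x :: "nat \<Rightarrow> nat" and j
  define args where "args x = (if q = ISA_Query then [Suc (offset ?A (dig x) (Suc d))]
    else [Suc (digit_rank ?A (dig x) (Suc d))])" for x
  have dig_less: "dig x j < ?A" if "x \<in> queries d B" for x j
    using that B by (auto simp: dig_def PiE_iff)
  have swap_less: "pair_swap F j (dig x j) < ?A" if "x \<in> queries d B" for F x j
    using digit_tower.\<sigma>_less[OF digit_tower_pair_swap[OF B] dig_less[OF that]] .
  have offset_less: "Suc (offset ?A p (Suc d)) < ?n" if "\<And>j. p j < ?A" for p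
    using offset_bound[of "Suc d" p ?A] that B by auto
  have rank_less: "Suc (digit_rank ?A p (Suc d)) < ?n" if "\<And>j. p j < ?A" for p
    using digit_rank_less[of "Suc d" p ?A] that power_less_tower_length[of ?A "Suc d"] B by auto
  have SA: "SA (tower_text d B F) (Suc (digit_rank ?A (dig x) (Suc d)))
      = Suc (offset ?A (\<lambda>j. pair_swap F j (dig x j)) (Suc d))" if "x \<in> queries d B" for F x
    using digit_tower.SA_tower[OF digit_tower_pair_swap[OF B]] dig_less[OF that] by blast
  have ISA: "ISA (tower_text d B F) (Suc (offset ?A (dig x) (Suc d)))
      = Suc (digit_rank ?A (\<lambda>j. pair_swap F j (dig x j)) (Suc d))" if "x \<in> queries d B" for F x
    using digit_tower.ISA_tower[OF digit_tower_pair_swap[OF B]] dig_less[OF that] by blast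
  have dig_top: "dig x d = 1" for x by (simp add: dig_def)
  have LCP: "LCP (tower_text d B F) (Suc (digit_rank ?A (dig x) (Suc d)))
      = tower_length ?A d - offset ?A (\<lambda>j. pair_swap F j (dig x j)) d + (?A - 1)"
    if "x \<in> queries d B" for F x
    using digit_tower.LCP_tower[where A = ?A and \<sigma> = "pair_swap F" and d = d and x = "dig x",
        OF digit_tower_pair_swap[OF B]] dig_less[OF that] dig_top by blast
  have digit_parity_eq: "digit_parity d F x = digit_parity d G x"
    if "\<And>j. j < d \<Longrightarrow> pair_swap F j (dig x j) = pair_swap G j (dig x j)" for F G x
    using that by (intro digit_parity_eq_of_pair_swap_eq) (simp add: dig_def)
  have off: "offset ?A (\<lambda>j. pair_swap F j (dig x j)) d \<le> tower_length ?A d"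
    if "x \<in> queries d B" for F x
    using offset_bound[of d "\<lambda>j. pair_swap F j (dig x j)" ?A] swap_less[OF that] by simp
  show ?thesis
    unfolding hard_texts_def
  proof (intro exI[of _ args] ballI conjI allI impI)
    fix x assume x: "x \<in> queries d B"
    show "args x \<in> query_args q ?n"
      using offset_less[of "dig x", OF dig_less[OF x]] rank_less[of "dig x", OF dig_less[OF x]] q
      by (cases q) (auto simp: args_def simp del: offset.simps digit_rank.simps tower_length.simps)
    fix F G
    let ?p = "\<lambda>F j. pair_swap F j (dig x j)"
    have "tower_length ?A d - offset ?A (?p F) d + (?A - 1) < ?n"
    proof -
      have "1 * (tower_length ?A d + Suc ?A) \<le> ?A * (tower_length ?A d + Suc ?A)"
        using B by (intro mult_le_mono1) auto
      then show ?thesis by simp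
    qed
    then show "query_answer q (tower_text d B F) (args x) < ?n"
      using q offset_less[of "?p F", OF swap_less[OF x]] rank_less[of "?p F", OF swap_less[OF x]]
      by (cases q) (simp_all only: args_def query_answer.simps SA[OF x] ISA[OF x] LCP[OF x]
          query_type.distinct if_True if_False nth_Cons_0 simp_thms)
    assume "query_answer q (tower_text d B F) (args x) = query_answer q (tower_text d B G) (args x)"
    then show "digit_parity d F x = digit_parity d G x"
    proof (cases q)
      case LCP_Query
      assume "query_answer q (tower_text d B F) (args x) = query_answer q (tower_text d B G) (args x)"
      \<comment> \<open>The bounds \<open>off\<close> ensure that the subtraction on naturals does
        not truncate, so it can be cancelled.\<close>
      then have eq: "offset ?A (?p F) d = offset ?A (?p G) d"
        using off[OF x, of F] off[OF x, of G]
        by (simp only: LCP_Query args_def query_answer.simps LCP[OF x] query_type.distinct if_False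
            nth_Cons_0)
      show ?thesis
        by (intro digit_parity_eq, rule offset_inj[of d "?p F" ?A "?p G", OF swap_less[OF x] swap_less[OF x] eq])
    next
      case SA_Query
      assume "query_answer q (tower_text d B F) (args x) = query_answer q (tower_text d B G) (args x)"
      then have eq: "offset ?A (?p F) (Suc d) = offset ?A (?p G) (Suc d)"
        by (simp only: SA_Query args_def query_answer.simps SA[OF x] query_type.distinct if_False
            nth_Cons_0 nat.inject)
      show ?thesis
        by (intro digit_parity_eq, rule offset_inj[of "Suc d" "?p F" ?A "?p G", OF swap_less[OF x] swap_less[OF x] eq]) simp
    next
      case ISA_Query
      assume "query_answer q (tower_text d B F) (args x) = query_answer q (tower_text d B G) (args x)"
      then have eq: "digit_rank ?A (?p F) (Suc d) = digit_rank ?A (?p G) (Suc d)"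
        by (simp only: ISA_Query args_def query_answer.simps ISA[OF x] simp_thms if_True
            nth_Cons_0 nat.inject)
      show ?thesis
        by (intro digit_parity_eq, rule digit_rank_inj[of "Suc d" "?p F" ?A "?p G", OF swap_less[OF x] swap_less[OF x] eq]) simp
    qed (use q in simp)
  qed
qed

text \<open>Each level adds one string, made of \<open>A\<close> blocks with one symbol for the
  lower tower and \<open>A + 1\<close> letters for the code.\<close>

lemma grammar_tower:
  assumes "digit_tower A \<sigma>"
  shows "\<exists>\<G>. grammar \<G> (A + j * (A * (A + 2))) \<and> tower A \<sigma> j \<in> \<G>"
proof (induction j)
  case 0
  have "concat (replicate A [False]) = replicate A False" by (induction A) auto
  moreover have "set (replicate A [False]) \<subseteq> {[False], [True]}" by auto
  ultimately have "grammar (insert (replicate A False) {[False], [True]}) A"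
    using grammar.rule[OF grammar.letters, of "replicate A [False]"] by (simp del: set_replicate)
  then show ?case by (intro exI[of _ "insert (replicate A False) {[False], [True]}"]) simp
next
  case (Suc j)
  then obtain \<G> where G: "grammar \<G> (A + j * (A * (A + 2)))" "tower A \<sigma> j \<in> \<G>" by auto
  define pieces where "pieces v = tower A \<sigma> j # map (\<lambda>c. [c]) (digit_code A (\<sigma> j v))" for v
  define ps where "ps = concat (map pieces [0..<A])"
  have "concat (concat (map pieces vs)) = concat (map (\<lambda>v. tower A \<sigma> j @ digit_code A (\<sigma> j v)) vs)" for vs
    by (induction vs) (simp_all add: pieces_def)
  then have ps: "concat ps = tower A \<sigma> (Suc j)" by (simp add: ps_def)
  have "length ps = A * (A + 2)"
    unfolding ps_def using digit_tower.\<sigma>_less[OF assms]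
    by (intro length_concat_same) (simp add: pieces_def length_digit_code)
  moreover have "set ps \<subseteq> \<G>" using G grammar_letter by (auto simp: ps_def pieces_def)
  ultimately have "grammar (insert (tower A \<sigma> (Suc j)) \<G>) (A + Suc j * (A * (A + 2)))"
    using grammar.rule[OF G(1), of ps] ps by (simp add: algebra_simps del: tower.simps)
  then show ?case by blast
qed

lemma tower_length_le: "2 \<le> A \<Longrightarrow> tower_length A j \<le> (4 * A) ^ Suc j"
proof (induction j)
  case (Suc j)
  define Z where "Z = (4 * A) ^ Suc j"
  have "4 * A \<le> Z" using Suc.prems by (simp add: Z_def)
  moreover have "tower_length A j \<le> Z" using Suc unfolding Z_def by blast
  ultimately have "tower_length A j + Suc A \<le> 4 * Z" using Suc.prems by linarith
  then have "A * (tower_length A j + Suc A) \<le> A * (4 * Z)" by (rule mult_le_mono2)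
  then show ?case by (simp add: Z_def)
qed simp

text \<open>The two families get common bounds here. The factor 8 is the 4 of
  \<open>tower_length_le\<close> times the 2 of \<open>A = 2 * B\<close>, and the constant 50 is a
  generous bound for both grammar sizes.\<close>

lemma ex_hard_texts:
  assumes "2 \<le> B" "1 \<le> d"
  obtains n T where "hard_texts q d B n T" "\<And>F. length (T F) = n" "2 ^ d \<le> n" "n \<le> (8 * B) ^ (d + 2)"
    "\<And>F. substring_complexity (T F) \<le> 50 * real d * real B ^ 2"
proof (cases "q = LCE_Query")
  case True
  let ?T = "\<lambda>F. parity_string B F False d @ [True]"
  show ?thesis
  proof (rule that)
    show "hard_texts q d B (Suc (B ^ d)) ?T" using hard_texts_LCE assms(1) True by simp
    show "length (?T F) = Suc (B ^ d)" for F by (simp add: length_parity_string)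
    have "2 ^ d \<le> B ^ d" using assms(1) by (intro power_mono) auto
    then show "2 ^ d \<le> Suc (B ^ d)" by simp
    have "Suc (B ^ d) \<le> B ^ Suc d"
    proof -
      have "2 * B ^ d \<le> B * B ^ d" using assms(1) by (rule mult_le_mono1)
      moreover have "1 \<le> B ^ d" using assms(1) by simp
      ultimately show ?thesis unfolding power_Suc by linarith
    qed
    also have "\<dots> \<le> (8 * B) ^ Suc d" by (intro power_mono) auto
    also have "\<dots> \<le> (8 * B) ^ (d + 2)" using assms(1) by (intro power_increasing) auto
    finally show "Suc (B ^ d) \<le> (8 * B) ^ (d + 2)" .
    fix F
    obtain A where A: "grammar A (2 * d * B)" "parity_string B F False d \<in> A"
      using grammar_parity_string[of d B F] by auto
    have "substring_complexity (?T F) \<le> 2 + 2 * real (2 * d * B + 2)"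
      using grammar_append[OF A grammar_letter[OF A(1)]] by (rule grammar_substring_complexity) auto
    also have "\<dots> \<le> 50 * real (d * B * B)"
    proof -
      define e where "e = d * B"
      have "1 \<le> e" "e \<le> e * B" using assms by (auto simp: e_def)
      then have "2 + 2 * (2 * e + 2) \<le> 50 * e" "50 * e \<le> 50 * (e * B)"
        by (simp, intro mult_le_mono2)
      then have "2 + 2 * (2 * e + 2) \<le> 50 * (e * B)" by (rule order.trans)
      then have "real (2 + 2 * (2 * e + 2)) \<le> real (50 * (e * B))" by (simp only: of_nat_le_iff)
      then show ?thesis by (simp add: e_def mult.assoc)
    qed
    finally show "substring_complexity (?T F) \<le> 50 * real d * real B ^ 2"
      by (simp add: power2_eq_square mult.assoc)
  qed
next
  case False
  have B1: "1 \<le> B" using assms by simp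
  note dt = digit_tower_pair_swap[OF B1]
  show ?thesis
  proof (rule that)
    show "hard_texts q d B (tower_length (2 * B) (Suc d)) (tower_text d B)"
      using hard_texts_tower B1 False by blast
    show len: "length (tower_text d B F) = tower_length (2 * B) (Suc d)" for F
      by (rule digit_tower.length_tower[OF dt])
    have "2 ^ d \<le> (2 * B) ^ Suc d"
      using assms(1) by (intro order.trans[OF power_increasing[of d "Suc d" 2] power_mono]) auto
    also have "\<dots> \<le> tower_length (2 * B) (Suc d)"
      using assms(1) by (intro less_imp_le power_less_tower_length) simp
    finally show "2 ^ d \<le> tower_length (2 * B) (Suc d)" .
    show "tower_length (2 * B) (Suc d) \<le> (8 * B) ^ (d + 2)"
      using tower_length_le[of "2 * B" "Suc d"] assms(1) by simp
    fix F
    obtain A where A: "grammar A (2 * B + Suc d * (2 * B * (2 * B + 2)))" "tower_text d B F \<in> A"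
      using grammar_tower[OF dt] by blast
    have "0 < length (tower_text d B F)"
      unfolding len using assms(1)
      by (intro le_less_trans[OF _ power_less_tower_length[of "2 * B" "Suc d"]]) auto
    then have "tower_text d B F \<noteq> []" by (rule length_greater_0_conv[THEN iffD1])
    with A have "substring_complexity (tower_text d B F)
        \<le> 2 + 2 * real (2 * B + Suc d * (2 * B * (2 * B + 2)))"
      by (rule grammar_substring_complexity)
    also have "\<dots> \<le> 50 * real (d * (B * B))"
    proof -
      define X Y Z where "X = Suc d * (2 * B * (2 * B + 2))" and "Y = B * B" and "Z = d * Y"
      have "2 * B \<le> Y" unfolding Y_def using assms(1) by (intro mult_le_mono1)
      moreover have "Y \<le> Z" using assms(2) by (simp add: Z_def)
      moreover have "2 * B * (2 * B + 2) = 4 * Y + 2 * (2 * B)" by (simp add: Y_def algebra_simps)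
      then have "2 * B * (2 * B + 2) \<le> 6 * Y" using \<open>2 * B \<le> Y\<close> by linarith
      then have "X \<le> (2 * d) * (6 * Y)"
        unfolding X_def by (rule mult_le_mono[rotated]) (use assms(2) in simp)
      then have "X \<le> 12 * Z" by (simp add: Z_def)
      ultimately have "2 + 2 * (2 * B + X) \<le> 50 * Z" using assms(1) by simp
      then have "2 + 2 * (2 * B + Suc d * (2 * B * (2 * B + 2))) \<le> 50 * (d * (B * B))"
        by (simp only: X_def Y_def Z_def)
      then have "real (2 + 2 * (2 * B + Suc d * (2 * B * (2 * B + 2)))) \<le> real (50 * (d * (B * B)))"
        by (simp only: of_nat_le_iff)
      then show ?thesis by simp
    qed
    finally show "substring_complexity (tower_text d B F) \<le> 50 * real d * real B ^ 2"
      by (simp add: power2_eq_square mult.assoc)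
  qed
qed

section \<open>The time bound\<close>

text \<open>A halted run no longer changes, so all queries may be run for the same number of steps,
  the rounded-down time bound. Since answers are below \<open>n\<close>, the output register holds
  them exactly.\<close>

lemma hard_texts_time_bound:
  fixes D :: "bool list \<Rightarrow> nat list" and \<tau> :: real
  assumes hard: "hard_texts q d B n T" and len: "\<And>F. length (T F) = n" and n: "n \<le> 2 ^ w"
    and words: "\<And>F a. a \<in> set (D (T F)) \<Longrightarrow> a < 2 ^ w"
    and size: "\<And>F. length (D (T F)) < 2 ^ s"
    and correct: "\<And>F xs. xs \<in> query_args q n \<Longrightarrow>
      computes_within w P (D (T F)) xs (query_answer q (T F) xs) \<tau>"
    and bound: "d + (s + w) * nat \<lfloor>\<tau>\<rfloor> < d * Y"
  shows "B ^ d \<le> 2 ^ (s * nat \<lfloor>\<tau>\<rfloor>) * Y ^ d"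
proof -
  obtain args where *: "\<forall>x\<in>queries d B. args x \<in> query_args q n \<and>
     (\<forall>F G. F \<subseteq> {..<d} \<times> {..<B} \<longrightarrow> G \<subseteq> {..<d} \<times> {..<B} \<longrightarrow>
        query_answer q (T F) (args x) < n \<and>
        (query_answer q (T F) (args x) = query_answer q (T G) (args x) \<longrightarrow> digit_parity d F x = digit_parity d G x))"
    using hard unfolding hard_texts_def by (elim exE)
  have args: "args x \<in> query_args q n" if "x \<in> queries d B" for x
    using *[rule_format, OF that] by (rule conjunct1)
  have less: "query_answer q (T F) (args x) < n"
    if "x \<in> queries d B" "F \<subseteq> {..<d} \<times> {..<B}" for x F
    using *[rule_format, OF that(1), THEN conjunct2, rule_format, OF that(2) that(2)] by (rule conjunct1)
  have digit_parity: "digit_parity d F x = digit_parity d G x"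
    if "x \<in> queries d B" "F \<subseteq> {..<d} \<times> {..<B}" "G \<subseteq> {..<d} \<times> {..<B}"
      "query_answer q (T F) (args x) = query_answer q (T G) (args x)" for x F G
    using *[rule_format, OF that(1), THEN conjunct2, rule_format, OF that(2,3), THEN conjunct2] that(4)
    by (rule mp)
  let ?t = "nat \<lfloor>\<tau>\<rfloor>"
  have result: "reg ((step w P ^^ ?t) (init_state w (D (T F)) (args x))) 0 = query_answer q (T F) (args x)"
    if x: "x \<in> queries d B" and F: "F \<subseteq> {..<d} \<times> {..<B}" for x F
  proof -
    obtain k where k: "real k \<le> \<tau>" "halted P ((step w P ^^ k) (init_state w (D (T F)) (args x)))"
      "reg ((step w P ^^ k) (init_state w (D (T F)) (args x))) 0 = query_answer q (T F) (args x) mod 2 ^ w"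
      using correct[OF args[OF x], of F] unfolding computes_within_def Let_def by blast
    have "k \<le> ?t" using k(1) by (rule le_nat_floor)
    then have "(step w P ^^ ?t) (init_state w (D (T F)) (args x)) =
        (step w P ^^ k) (init_state w (D (T F)) (args x))"
      using funpow_step_halted[OF k(2)] by blast
    moreover have "query_answer q (T F) (args x) < 2 ^ w" using less[OF x F] n by linarith
    ultimately show ?thesis using k(3) by simp
  qed
  show ?thesis
  proof (rule parity_cell_probe_bound[where M = "\<lambda>F. D (T F)" and S = "2 ^ s - 1" and args = args
        and w = w and P = P])
    fix F G x assume F: "F \<subseteq> {..<d} \<times> {..<B}" and G: "G \<subseteq> {..<d} \<times> {..<B}"
      and x: "x \<in> queries d B"
      and eq: "reg ((step w P ^^ ?t) (init_state w (D (T F)) (args x))) 0 =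
        reg ((step w P ^^ ?t) (init_state w (D (T G)) (args x))) 0"
    show "digit_parity d F x = digit_parity d G x"
      by (rule digit_parity[OF x F G eq[unfolded result[OF x F] result[OF x G]]])
  next
    fix F show "length (D (T F)) \<le> 2 ^ s - 1" using size[of F] by simp
  next
    fix F a assume "a \<in> set (D (T F))"
    then show "a < 2 ^ w" by (rule words)
  next
    show "d + (s + w) * ?t < d * Y" by (rule bound)
  qed simp
qed

text \<open>An exponential outgrows a linear term: with \<open>h = 2 * m\<close> and
  \<open>2 * \<kappa> \<le> m\<close> the product is at most \<open>m * m\<close>, while
  \<open>2 ^ h\<close> is at least \<open>(m + 1) * (m + 1)\<close>.\<close>

lemma ex_large_power:
  fixes c \<kappa> :: nat and r :: real
  obtains h :: nat where "1 \<le> h" "c \<le> h" "r \<le> 2 ^ h" "h * \<kappa> + 2 \<le> 2 ^ h"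
proof -
  define m where "m = Max {1, c, 2 * \<kappa>, nat \<lceil>r\<rceil>}"
  have m: "1 \<le> m" "c \<le> m" "2 * \<kappa> \<le> m" "nat \<lceil>r\<rceil> \<le> m"
    unfolding m_def by (rule Max_ge; simp)+
  have "m + 1 \<le> 2 ^ m" using less_exp[of m] by (simp add: Suc_le_eq)
  then have "(m + 1) * (m + 1) \<le> 2 ^ m * 2 ^ m" by (intro mult_le_mono)
  then have sq: "(m + 1) * (m + 1) \<le> 2 ^ (2 * m)" by (simp add: mult_2 power_add)
  show ?thesis
  proof (rule that[of "2 * m"])
    show "1 \<le> 2 * m" "c \<le> 2 * m" using m by auto
    have "m \<le> 2 ^ (2 * m)" using sq by simp
    then have "real m \<le> 2 ^ (2 * m)" by (metis of_nat_le_iff of_nat_numeral of_nat_power)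
    then show "r \<le> 2 ^ (2 * m)" using m(4) by linarith
    have "2 * m * \<kappa> = m * (2 * \<kappa>)" by simp
    also have "\<dots> \<le> m * m" using m(3) by (rule mult_le_mono2)
    finally have "2 * m * \<kappa> + 2 \<le> m * m + 2 * m + 1" using m(1) by linarith
    also have "\<dots> = (m + 1) * (m + 1)" by simp
    finally show "2 * m * \<kappa> + 2 \<le> 2 ^ (2 * m)" using sq by (rule order.trans)
  qed
qed

theorem theorem1p1:
  fixes w :: "nat \<Rightarrow> nat" and q :: query_type
  assumes "\<And>n. n \<ge> 1 \<Longrightarrow> real (w n) \<ge> log 2 (real n)"
    and "\<exists>c::nat. (\<lambda>n. real (w n)) \<in> O(\<lambda>n. log 2 (real n) ^ c)"
  shows "\<not> (\<exists>D P t. answers_queries q w D P t \<and>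
            delta_polylog_space D \<and>
            t \<in> o(\<lambda>n. log 2 (real n) / log 2 (log 2 (real n))))"
proof
  assume "\<exists>D P t. answers_queries q w D P t \<and> delta_polylog_space D \<and>
            t \<in> o(\<lambda>n. log 2 (real n) / log 2 (log 2 (real n)))"
  then obtain D P t where ans: "answers_queries q w D P t" and space: "delta_polylog_space D"
    and time: "t \<in> o(\<lambda>n. log 2 (real n) / log 2 (log 2 (real n)))" by blast
  obtain b where "(\<lambda>n. real (w n)) \<in> O(\<lambda>n. log 2 (real n) ^ b)" using assms(2) by blast
  then obtain C\<^sub>w where "C\<^sub>w > 0" "\<forall>\<^sub>F n in sequentially. norm (real (w n)) \<le> C\<^sub>w * norm (log 2 (real n) ^ b)"
    by (rule landau_o.bigE)
  then obtain N\<^sub>w where w_le: "\<And>n. n \<ge> N\<^sub>w \<Longrightarrow> real (w n) \<le> C\<^sub>w * \<bar>log 2 (real n) ^ b\<bar>"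
    by (auto simp: eventually_at_top_linorder)
  obtain c where "(\<lambda>T. real (length (D T)))
      \<in> O[long_texts](\<lambda>T. substring_complexity T * log 2 (real (length T)) ^ c)"
    using space unfolding delta_polylog_space_def by blast
  then obtain C where C: "C > 0" "\<forall>\<^sub>F T in long_texts. norm (real (length (D T))) \<le>
      C * norm (substring_complexity T * log 2 (real (length T)) ^ c)"
    by (rule landau_o.bigE)
  then obtain N\<^sub>s where space_le: "\<And>T. length T \<ge> N\<^sub>s \<Longrightarrow> real (length (D T)) \<le>
      C * \<bar>substring_complexity T * log 2 (real (length T)) ^ c\<bar>"
    by (auto simp: eventually_filtercomap_at_top_linorder)
  obtain N\<^sub>a where N\<^sub>a: "\<And>T x. length T \<ge> N\<^sub>a \<Longrightarrow> x \<in> set (D T) \<Longrightarrow> x < 2 ^ w (length T)"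
    "\<And>T xs. length T \<ge> N\<^sub>a \<Longrightarrow> xs \<in> query_args q (length T) \<Longrightarrow>
      computes_within (w (length T)) P (D T) xs (query_answer q T xs) (t (length T))"
    using ans unfolding answers_queries_def eventually_filtercomap_at_top_linorder by blast

  \<comment> \<open>With \<open>d = 2 ^ h\<close> and \<open>B = d ^ K\<close>, the space is below
    \<open>d ^ \<kappa>\<close>, the word size is at most \<open>d ^ (2 * b + 1)\<close>, and
    \<open>Y\<close> becomes \<open>d ^ (2 * b + 2)\<close>. As \<open>K\<close> exceeds that
    exponent by one, a factor \<open>d ^ d\<close> is left for the \<open>d ^ (\<kappa> * t)\<close>
    probe sequences. The constant \<open>\<eta>\<close> makes \<open>t\<close> at most
    \<open>d / (2 * \<kappa>)\<close>.\<close>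
  define K where "K = 2 * b + 3"
  define \<kappa> where "\<kappa> = 2 * c + 3 + 2 * K"
  define c\<^sub>1 where "c\<^sub>1 = real (3 * (3 + K))"
  define \<eta> where "\<eta> = 1 / (2 * real \<kappa> * c\<^sub>1)"
  have pos: "0 < c\<^sub>1" "0 < \<eta>" "0 < real \<kappa>" by (auto simp: c\<^sub>1_def \<eta>_def \<kappa>_def)
  have "\<forall>\<^sub>F n in sequentially. norm (t n) \<le> \<eta> * norm (log 2 (real n) / log 2 (log 2 (real n)))"
    using landau_o.smallD[OF time pos(2)] .
  then obtain N\<^sub>t where t_le: "\<And>n. n \<ge> N\<^sub>t \<Longrightarrow> t n \<le> \<eta> * \<bar>log 2 (real n) / log 2 (log 2 (real n))\<bar>"
    by (auto simp: eventually_at_top_linorder abs_le_iff)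

  \<comment> \<open>The second condition puts \<open>n\<close>, which exceeds \<open>h\<close>,
    beyond all thresholds, and the third lets one factor \<open>d\<close> absorb the hidden
    constants.\<close>
  obtain h where h: "1 \<le> h" "Max {N\<^sub>w, N\<^sub>s, N\<^sub>a, N\<^sub>t} \<le> h"
    "max (C\<^sub>w * c\<^sub>1 ^ b) (50 * C * c\<^sub>1 ^ c + 1) \<le> 2 ^ h" "h * \<kappa> + 2 \<le> 2 ^ h"
    by (rule ex_large_power)
  define d where "d = (2::nat) ^ h"
  define B where "B = d ^ K"
  have d2: "2 \<le> d" unfolding d_def using h(1) power_increasing[of 1 h "2::nat"] by simp
  have hd: "h < d" unfolding d_def by (rule less_exp)
  have B2: "2 \<le> B" unfolding B_def K_def using d2 by (intro order.trans[OF d2 self_le_power]) auto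
  obtain n T where hard: "hard_texts q d B n T" and len: "\<And>F. length (T F) = n"
    and n_ge: "2 ^ d \<le> n" and n_le: "n \<le> (8 * B) ^ (d + 2)"
    and \<delta>: "\<And>F. substring_complexity (T F) \<le> 50 * real d * real B ^ 2"
    using ex_hard_texts[OF B2, of d q] d2 by auto
  have "h < n" using hd n_ge less_exp[of d] by linarith
  then have N: "N\<^sub>w \<le> n" "N\<^sub>s \<le> n" "N\<^sub>a \<le> n" "N\<^sub>t \<le> n" using h(2) by auto

  define L where "L = log 2 (real n)"
  have n0: "0 < n" using \<open>h < n\<close> by simp
  have Ld: "real d \<le> L"
    unfolding L_def using n_ge by (rule le_log2_of_power)
  have L_le: "L \<le> c\<^sub>1 * real d * real h"
  proof -
    have "8 * B = 2 ^ (3 + h * K)" by (simp add: B_def d_def power_add power_mult)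
    then have "n \<le> 2 ^ ((3 + h * K) * (d + 2))" using n_le by (simp only: power_mult)
    then have "L \<le> real ((3 + h * K) * (d + 2))" unfolding L_def using n0 by (intro log2_of_power_le) auto
    also have "(3 + h * K) * (d + 2) \<le> ((3 + K) * h) * (3 * d)"
      using h(1) d2 by (intro mult_le_mono) (auto simp: algebra_simps)
    also have "real (((3 + K) * h) * (3 * d)) = c\<^sub>1 * real d * real h" by (simp add: c\<^sub>1_def)
    finally show ?thesis by simp
  qed
  have L0: "0 \<le> L" using Ld by simp
  have L_le2: "L \<le> c\<^sub>1 * real d ^ 2"
  proof -
    have "c\<^sub>1 * real d * real h \<le> c\<^sub>1 * real d * real d" using hd pos by (intro mult_left_mono) auto
    then show ?thesis using L_le by (simp add: power2_eq_square)
  qed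
  have loglog: "real h \<le> log 2 L"
  proof -
    have "2 ^ h \<le> L" using Ld by (simp add: d_def)
    then show ?thesis by (metis L0 le_log_of_power one_less_numeral_iff semiring_norm(76))
  qed

  \<comment> \<open>Here \<open>L\<close> is at most \<open>c\<^sub>1 * d * h\<close> and its
    logarithm at least \<open>h\<close>, so the quotient in the time bound is at most
    \<open>c\<^sub>1 * d\<close>.\<close>
  let ?t = "nat \<lfloor>t n\<rfloor>"
  have "real ?t \<le> \<eta> * \<bar>L / log 2 L\<bar>"
  proof -
    have "0 \<le> \<eta> * \<bar>L / log 2 L\<bar>" using pos by simp
    then show ?thesis using t_le[OF N(4)] unfolding L_def by linarith
  qed
  also have "\<bar>L / log 2 L\<bar> = L / log 2 L" using loglog L0 by simp
  also have "L / log 2 L \<le> (c\<^sub>1 * real d * real h) / real h"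
    using loglog L_le L0 h(1) by (intro frac_le) auto
  also have "\<dots> = c\<^sub>1 * real d" using h(1) by simp
  finally have "real ?t \<le> \<eta> * (c\<^sub>1 * real d)" using pos by simp
  also have "\<dots> = real d / (2 * real \<kappa>)" using pos by (simp add: \<eta>_def)
  finally have "real ?t * (2 * real \<kappa>) \<le> real d" using pos by (subst (asm) pos_le_divide_eq) auto
  then have "real (?t * (2 * \<kappa>)) \<le> real d" by simp
  then have t2: "?t * (2 * \<kappa>) \<le> d" by (simp only: of_nat_le_iff)
  have t\<kappa>: "\<kappa> * ?t < d" using t2 d2 by (simp add: algebra_simps)
  have td: "?t \<le> d"
  proof -
    have "?t \<le> \<kappa> * ?t" by (simp add: \<kappa>_def)
    then show ?thesis using t\<kappa> by linarith
  qed

  have w_d: "w n \<le> d ^ (2 * b + 1)"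
  proof -
    have "real (w n) \<le> C\<^sub>w * L ^ b" using w_le[OF N(1)] L0 by (simp add: L_def)
    also have "\<dots> \<le> C\<^sub>w * (c\<^sub>1 * real d ^ 2) ^ b"
      using L_le2 L0 \<open>C\<^sub>w > 0\<close> by (intro mult_left_mono power_mono) auto
    also have "\<dots> = (C\<^sub>w * c\<^sub>1 ^ b) * real d ^ (2 * b)" by (simp add: power_mult_distrib power_mult)
    also have "\<dots> \<le> real d * real d ^ (2 * b)"
      using h(3) by (intro mult_right_mono) (auto simp: d_def)
    finally have "real (w n) \<le> real (d ^ (2 * b + 1))" by simp
    then show ?thesis by (simp only: of_nat_le_iff)
  qed

  have size: "length (D (T F)) < 2 ^ (h * \<kappa>)" for F
  proof -
    have "0 \<le> substring_complexity (T F)"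
    proof -
      have "real (num_substrings n (T F)) / real n \<le> substring_complexity (T F)"
        unfolding substring_complexity_def len using n0 by (intro Max_ge) auto
      then show ?thesis by (rule order.trans[rotated]) simp
    qed
    then have "real (length (D (T F))) \<le> C * (substring_complexity (T F) * L ^ c)"
      using space_le[of "T F"] N(2) L0 by (simp add: len L_def)
    also have "\<dots> \<le> C * ((50 * real d * real B ^ 2) * (c\<^sub>1 * real d ^ 2) ^ c)"
      using \<delta>[of F] L_le2 L0 C(1) by (intro mult_left_mono mult_mono power_mono) auto
    also have "\<dots> = (50 * C * c\<^sub>1 ^ c) * (real d ^ (2 * c + 1) * real B ^ 2)"
      by (simp add: power_mult_distrib power_mult)
    \<comment> \<open>A further copy of this product, which is at least 1, makes room for the 1 that
      turns the size bound into a strict one.\<close>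
    also have "1 * 1 \<le> real d ^ (2 * c + 1) * real B ^ 2"
      using d2 B2 by (intro mult_mono one_le_power) auto
    then have "(50 * C * c\<^sub>1 ^ c) * (real d ^ (2 * c + 1) * real B ^ 2) \<le>
        (50 * C * c\<^sub>1 ^ c) * (real d ^ (2 * c + 1) * real B ^ 2) + 1 * (real d ^ (2 * c + 1) * real B ^ 2) - 1"
      by simp
    finally have "real (length (D (T F))) + 1 \<le>
        (50 * C * c\<^sub>1 ^ c) * (real d ^ (2 * c + 1) * real B ^ 2) + 1 * (real d ^ (2 * c + 1) * real B ^ 2)"
      by simp
    also have "\<dots> = (50 * C * c\<^sub>1 ^ c + 1) * (real d ^ (2 * c + 1) * real B ^ 2)"
      by (simp only: distrib_right)
    also have "\<dots> \<le> real d * (real d ^ (2 * c + 1) * real B ^ 2)"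
      using h(3) by (intro mult_right_mono) (auto simp: d_def)
    also have "\<dots> = real (d ^ (2 * c + 2 + 2 * K))"
      by (simp add: B_def power_add power_mult[symmetric] mult.commute[of K])
    also have "\<dots> \<le> real (d ^ \<kappa>)"
      using d2 by (simp only: of_nat_le_iff) (intro power_increasing, auto simp: \<kappa>_def)
    also have "\<dots> = real (2 ^ (h * \<kappa>))" by (simp add: d_def power_mult)
    finally have "real (Suc (length (D (T F)))) \<le> real (2 ^ (h * \<kappa>))" by simp
    then show ?thesis by (simp only: of_nat_le_iff Suc_le_eq)
  qed

  have "B ^ d \<le> 2 ^ (h * \<kappa> * ?t) * (d ^ (2 * b + 2)) ^ d"
  proof (rule hard_texts_time_bound[OF hard len])
    have "real n = 2 powr L" using n0 by (simp add: L_def)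
    also have "\<dots> \<le> 2 powr real (w n)" using assms(1)[of n] n0 by (intro powr_mono) (auto simp: L_def)
    also have "\<dots> = real (2 ^ w n)" by (simp add: powr_realpow)
    finally show "n \<le> 2 ^ w n" by (simp only: of_nat_le_iff)
    \<comment> \<open>The crude \<open>?t \<le> d\<close> suffices here: space exponent and word
      size are dominated by \<open>d ^ (2 * b + 2)\<close>. The sharper bound on \<open>?t\<close>
      is for the last contradiction.\<close>
    have "d + (h * \<kappa> + w n) * ?t \<le> d + (h * \<kappa> + w n) * d" using td by simp
    also have "\<dots> = d * (1 + h * \<kappa> + w n)" by (simp add: algebra_simps)
    also have "\<dots> < d * d ^ (2 * b + 2)"
    proof -
      have "d \<le> d ^ (2 * b + 1)" using d2 by (intro self_le_power) auto
      moreover have "2 * d ^ (2 * b + 1) \<le> d * d ^ (2 * b + 1)" using d2 by (rule mult_le_mono1)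
      moreover have "1 + h * \<kappa> < d" using h(4) by (simp add: d_def)
      moreover have "d ^ (2 * b + 2) = d * d ^ (2 * b + 1)" by simp
      ultimately have "1 + h * \<kappa> + w n < d ^ (2 * b + 2)" using w_d by linarith
      then show ?thesis using d2 by (intro mult_strict_left_mono) auto
    qed
    finally show "d + (h * \<kappa> + w n) * ?t < d * d ^ (2 * b + 2)" .
  qed (use size N\<^sub>a[of "T _"] N(3) len in auto)
  also have "\<dots> = 2 ^ (h * \<kappa> * ?t + h * (2 * b + 2) * d)"
    by (simp only: power_add power_mult d_def)
  also have "B ^ d = 2 ^ (h * K * d)"
    by (simp add: B_def d_def power_mult)
  \<comment> \<open>Cancelling \<open>h\<close> and \<open>(2 * b + 2) * d\<close> leaves
    \<open>d \<le> \<kappa> * ?t\<close>.\<close>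
  finally have "h * K * d \<le> h * \<kappa> * ?t + h * (2 * b + 2) * d"
    by (rule power_le_imp_le_exp[rotated]) simp
  then have "h * (K * d) \<le> h * (\<kappa> * ?t + (2 * b + 2) * d)" by (simp add: algebra_simps)
  then have "K * d \<le> \<kappa> * ?t + (2 * b + 2) * d" using h(1) by simp
  moreover have "K * d = (2 * b + 2) * d + d" by (simp add: K_def algebra_simps)
  ultimately show False using t\<kappa> by linarith
qed

end
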